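(* There exist parameter values $(\lambda,\mu,\theta,\kappa,\tau)$ of the symmetric switching fluid model and initial conditions $x(0)\in\mathbb{S}$ satisfying $$q_1(0)>0,\quad q_2(0)>q_1(0)+\kappa,\quad z_{1,2}(0)=\tau,\quad 0\le z_{2,1}(0)<\tau,$$ for which $\mathcal{O}\neq\emptyset$, where $\mathcal{O}\subset\mathbb{S}$ is the set of initial states from which the solution $x$ switches infinitely often as $t\to\infty$ (oscillates indefinitely).
   Context: Parameters (symmetric X model): $0<\lambda<1$, $0<\mu<1$, $\theta>0$, $\kappa>0$, $\tau>0$, with the standing assumptions $\lambda\le 1-\tau$ and $\theta<\mu$. Service rates are $\mu_{1,1}=\mu_{2,2}=1$, $\mu_{1,2}=\mu_{2,1}=\mu$; each of the two service pools has capacity $1$. State: $x=(q_1,q_2,z_{1,1},z_{1,2},z_{2,1},z_{2,2})\in\mathbb{S}=[0,\lambda/\theta]^2\times[0,1]^4$, where $q_i$ is the class-$i$ queue content and $z_{i,j}$ is the class-$i$ fluid in service in pool $j$, with $z_{1,1}+z_{2,1}\le1$, $z_{1,2}+z_{2,2}\le 1$ (pool $j$ is full if equality holds; both pools are full at time $0$ in the displayed initial conditions). Put $d_{1,2}=q_1-q_2-\kappa$, $d_{2,1}=q_2-q_1-\kappa$, and let the sliding manifold $\mathbb{S}_{i,j}$ be the set of $x\in\mathbb{S}$ with $d_{i,j}=0$ and both pools full. Switching fluid model (fluid version of the FQR-ART control): $x$ is continuous and almost everywhere differentiable. Class-$i$ fluid arrives at rate $\lambda$, abandons queue $i$ at rate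 $\theta q_i$, and leaves service in pool $j$ at rate $\mu_{i,j}z_{i,j}$. A pool never idles while its own queue is positive. Released capacity is assigned as follows, for $(i,j)=(1,2)$ and $(i,j)=(2,1)$. (1) Active sharing: if both pools are full, $d_{i,j}>0$ and $z_{j,i}\le\tau$, both pools take new fluid only from queue $i$: $\dot q_i=\lambda-\theta q_i-(z_{1,1}+\mu z_{2,1}+\mu z_{1,2}+z_{2,2})$, $\dot q_j=\lambda-\theta q_j$, $\dot z_{j,j}=-z_{j,j}$, $z_{i,j}=1-z_{j,j}$, $\dot z_{j,i}=-\mu z_{j,i}$, $z_{i,i}=1-z_{j,i}$. (2) No active sharing: if both pools are full and, for each of the two pairs $(i,j)$, $d_{i,j}<0$ or $z_{j,i}>\tau$, each pool takes fluid only from its own queue: $\dot q_i=\lambda-\theta q_i-z_{i,i}-\mu z_{j,i}$, $\dot z_{j,i}=-\mu z_{j,i}$, $z_{i,i}=1-z_{j,i}$ (while $q_i>0$). (3) Sliding: if $x\in\mathbb{S}_{i,j}$ and $z_{j,i}\le\tau$, pool $i$ takes only class-$i$ fluid and pool $j$ splits its released capacity between queues $i$ and $j$ so that $d_{i,j}=0$ is maintained, when this is possible. (4) When $q_i=0$ and pool $i$ can absorb all arriving class-$i$ fluid, that fluid enters pool $i$ immediately; without sharing, if pool $i$ is not full, $\dot z_{i,i}=\lambda-z_{i,i}$ and $\dot z_{j,i}=-\mu z_{j,i}$. (5) Spare capacity: if pool $j$ is not full and $q_i\ge\kappa$, pool $j$ also accepts class-$i$ fluid regardless of the value of $z_{j,i}$,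 but class $j$ has strict priority in pool $j$ whenever $z_{j,i}>\tau$. The solution switches whenever its dynamics change between active sharing in one direction, no active sharing, and active sharing in the other direction; it oscillates when it keeps crossing both sliding manifolds. *)

theory Defs
  imports "HOL-Analysis.Analysis"
begin

text \<open>
  Symmetric X model: two customer classes and two service pools, both indexed by the
  two-element type \<open>2\<close>. Class \<open>i\<close> is served at rate \<open>1\<close> in its own pool
  \<open>i\<close> and at rate \<open>mu\<close> in the other one.
\<close>

record params =
  lam :: real    \<comment> \<open>arrival rate of each class\<close>
  mu :: real     \<comment> \<open>service rate in the other class's pool\<close>
  theta :: real  \<comment> \<open>abandonment rate\<close>
  kappa :: real  \<comment> \<open>activation threshold\<close>
  tau :: real    \<comment> \<open>release threshold\<close>

definition standing_assumptions :: "params \<Rightarrow> bool" where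
  "standing_assumptions P \<longleftrightarrow>
     0 < lam P \<and> lam P < 1 \<and> 0 < mu P \<and> mu P < 1 \<and>
     0 < theta P \<and> 0 < kappa P \<and> 0 < tau P \<and>
     lam P \<le> 1 - tau P \<and> theta P < mu P"

type_synonym state = "(real ^ 2) \<times> (real ^ 2 ^ 2)"

abbreviation queue :: "state \<Rightarrow> 2 \<Rightarrow> real" where
  "queue x i \<equiv> fst x $ i"

text \<open>\<open>serv x i j\<close> is the class-\<open>i\<close> fluid in service in pool \<open>j\<close>.\<close>

abbreviation serv :: "state \<Rightarrow> 2 \<Rightarrow> 2 \<Rightarrow> real" where
  "serv x i j \<equiv> snd x $ i $ j"

definition state_space :: "params \<Rightarrow> state set" where
  "state_space P =
     {x. (\<forall>i. 0 \<le> queue x i \<and> queue x i \<le> lam P / theta P) \<and>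
         (\<forall>i j. 0 \<le> serv x i j \<and> serv x i j \<le> 1) \<and>
         (\<forall>j. serv x 1 j + serv x 2 j \<le> 1)}"

definition full :: "state \<Rightarrow> 2 \<Rightarrow> bool" where
  "full x j \<longleftrightarrow> serv x 1 j + serv x 2 j = 1"

definition both_full :: "state \<Rightarrow> bool" where
  "both_full x \<longleftrightarrow> (\<forall>j. full x j)"

definition dif :: "params \<Rightarrow> 2 \<Rightarrow> 2 \<Rightarrow> state \<Rightarrow> real" where
  "dif P i j x = queue x i - queue x j - kappa P"

definition sliding_manifold :: "params \<Rightarrow> 2 \<Rightarrow> 2 \<Rightarrow> state set" where
  "sliding_manifold P i j = {x \<in> state_space P. dif P i j x = 0 \<and> both_full x}"

definition service_rate :: "params \<Rightarrow> 2 \<Rightarrow> 2 \<Rightarrow> real" where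
  "service_rate P i j = (if i = j then 1 else mu P)"

definition released :: "params \<Rightarrow> state \<Rightarrow> 2 \<Rightarrow> real" where
  "released P x j = service_rate P 1 j * serv x 1 j + service_rate P 2 j * serv x 2 j"

text \<open>In a pair \<open>(i, j)\<close> with \<open>i \<noteq> j\<close>, class \<open>i\<close> is the class being helped by pool \<open>j\<close>.\<close>

definition active_sharing :: "params \<Rightarrow> 2 \<Rightarrow> 2 \<Rightarrow> state set" where
  "active_sharing P i j =
     {x \<in> state_space P. both_full x \<and> dif P i j x > 0 \<and> serv x j i \<le> tau P}"

definition sliding :: "params \<Rightarrow> 2 \<Rightarrow> 2 \<Rightarrow> state set" where
  "sliding P i j = {x \<in> sliding_manifold P i j. serv x j i \<le> tau P}"

definition no_active_sharing :: "params \<Rightarrow> state set" where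
  "no_active_sharing P =
     {x \<in> state_space P. both_full x \<and>
        (\<forall>i j. i \<noteq> j \<longrightarrow> dif P i j x < 0 \<or> serv x j i > tau P)}"

text \<open>
  The control chooses the matrix \<open>u\<close> of nonnegative rates \<open>u $ i $ j\<close> at which
  class-\<open>i\<close> fluid enters service in pool \<open>j\<close>; \<open>velocity P x u\<close> is the resulting
  time derivative of the state.
\<close>

definition velocity :: "params \<Rightarrow> state \<Rightarrow> real ^ 2 ^ 2 \<Rightarrow> state" where
  "velocity P x u =
     ((\<chi> i. lam P - theta P * queue x i - (u $ i $ 1 + u $ i $ 2)),
      (\<chi> i j. u $ i $ j - service_rate P i j * serv x i j))"

definition sharing_alloc :: "params \<Rightarrow> 2 \<Rightarrow> 2 \<Rightarrow> state \<Rightarrow> real ^ 2 ^ 2 \<Rightarrow> bool" where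
  "sharing_alloc P i j x u \<longleftrightarrow>
     u $ i $ i = released P x i \<and> u $ i $ j = released P x j \<and>
     u $ j $ i = 0 \<and> u $ j $ j = 0"

definition split_alloc :: "params \<Rightarrow> 2 \<Rightarrow> 2 \<Rightarrow> state \<Rightarrow> real ^ 2 ^ 2 \<Rightarrow> bool" where
  "split_alloc P i j x u \<longleftrightarrow>
     u $ i $ i = released P x i \<and> u $ j $ i = 0 \<and>
     0 \<le> u $ i $ j \<and> 0 \<le> u $ j $ j \<and> u $ i $ j + u $ j $ j = released P x j"

text \<open>\<open>keeps_dif P i j x u\<close>: the derivative of \<open>dif P i j\<close> along \<open>velocity P x u\<close> vanishes.\<close>

definition keeps_dif :: "params \<Rightarrow> 2 \<Rightarrow> 2 \<Rightarrow> state \<Rightarrow> real ^ 2 ^ 2 \<Rightarrow> bool" where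
  "keeps_dif P i j x u \<longleftrightarrow> queue (velocity P x u) i - queue (velocity P x u) j = 0"

text \<open>
  If no split keeps \<open>dif P i j\<close> at zero, the solution leaves the manifold at once, and
  the split at that single instant is irrelevant.
\<close>

definition sliding_alloc :: "params \<Rightarrow> 2 \<Rightarrow> 2 \<Rightarrow> state \<Rightarrow> real ^ 2 ^ 2 \<Rightarrow> bool" where
  "sliding_alloc P i j x u \<longleftrightarrow>
     split_alloc P i j x u \<and>
     ((\<exists>w. split_alloc P i j x w \<and> keeps_dif P i j x w) \<longrightarrow> keeps_dif P i j x u)"

text \<open>
  Pool \<open>j\<close> has spare capacity if it is not full, or if it is full but releases capacity
  faster than its own class, with empty queue, can use it.
\<close>

definition spare :: "params \<Rightarrow> state \<Rightarrow> 2 \<Rightarrow> bool" where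
  "spare P x j \<longleftrightarrow> queue x j = 0 \<and> (\<not> full x j \<or> released P x j > lam P)"

text \<open>
  Pool \<open>j\<close> when neither active sharing nor sliding takes place. Its own class has
  priority: a positive queue takes all released capacity; with an empty queue the arriving
  fluid enters as far as it can be absorbed. Only spare capacity is offered to the other class
  \<open>i\<close>, and only if its queue is at least \<open>kappa\<close>. The rate at which that capacity is
  taken is determined by the state constraints: by \<open>non_idling\<close> below, the pool
  stays full while \<open>queue x i > kappa\<close>, and if it is not full and the queue stays at
  \<open>kappa\<close>, it takes the excess of class \<open>i\<close>.
\<close>

definition own_alloc :: "params \<Rightarrow> 2 \<Rightarrow> 2 \<Rightarrow> state \<Rightarrow> real ^ 2 ^ 2 \<Rightarrow> bool" where
  "own_alloc P i j x u \<longleftrightarrow>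
     u $ j $ j = (if queue x j > 0 then released P x j
                  else if full x j then min (lam P) (released P x j)
                  else lam P) \<and>
     0 \<le> u $ i $ j \<and>
     (u $ i $ j > 0 \<longrightarrow> spare P x j \<and> queue x i \<ge> kappa P)"

definition admissible :: "params \<Rightarrow> state \<Rightarrow> real ^ 2 ^ 2 \<Rightarrow> bool" where
  "admissible P x u \<longleftrightarrow>
     (\<forall>i j. i \<noteq> j \<longrightarrow>
        (x \<in> active_sharing P i j \<longrightarrow> sharing_alloc P i j x u) \<and>
        (x \<in> sliding P i j \<longrightarrow> sliding_alloc P i j x u)) \<and>
     ((\<forall>i j. i \<noteq> j \<longrightarrow> x \<notin> active_sharing P i j \<and> x \<notin> sliding P i j) \<longrightarrow>
        (\<forall>i j. i \<noteq> j \<longrightarrow> own_alloc P i j x u))"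

text \<open>
  A pool is full while its own queue is positive, and also while the other queue exceeds
  \<open>kappa\<close>: fluid waiting in that queue would fill idle capacity instantaneously.
\<close>

definition non_idling :: "params \<Rightarrow> state \<Rightarrow> bool" where
  "non_idling P x \<longleftrightarrow>
     (\<forall>j. queue x j > 0 \<longrightarrow> full x j) \<and>
     (\<forall>i j. i \<noteq> j \<longrightarrow> queue x i > kappa P \<longrightarrow> full x j)"

text \<open>
  Solutions are continuous, almost everywhere differentiable, and the integral of their
  derivative (absolutely continuous). Without the last requirement, singular functions such as
  Cantor's could be added to a solution.
\<close>

definition fluid_solution :: "params \<Rightarrow> (real \<Rightarrow> state) \<Rightarrow> bool" where
  "fluid_solution P x \<longleftrightarrow>
     continuous_on {0..} x \<and>
     (\<forall>t\<ge>0. x t \<in> state_space P \<and> non_idling P (x t)) \<and>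
     (\<exists>v N. negligible N \<and>
        (\<forall>t\<ge>0. (v has_integral (x t - x 0)) {0..t}) \<and>
        (\<forall>t>0. t \<notin> N \<longrightarrow>
           (x has_vector_derivative v t) (at t) \<and>
           (\<exists>u. admissible P (x t) u \<and> v t = velocity P (x t) u)))"

definition regimes :: "params \<Rightarrow> state set set" where
  "regimes P = {active_sharing P 1 2, no_active_sharing P, active_sharing P 2 1}"

definition switch_time :: "params \<Rightarrow> (real \<Rightarrow> state) \<Rightarrow> real \<Rightarrow> bool" where
  "switch_time P x t \<longleftrightarrow>
     (\<exists>A\<in>regimes P. \<exists>B\<in>regimes P. A \<noteq> B \<and>
        (\<forall>\<^sub>F s in at_left t. x s \<in> A) \<and> (\<forall>\<^sub>F s in at_right t. x s \<in> B))"

definition crossing_time :: "params \<Rightarrow> 2 \<Rightarrow> 2 \<Rightarrow> (real \<Rightarrow> state) \<Rightarrow> real \<Rightarrow> bool" where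
  "crossing_time P i j x t \<longleftrightarrow>
     x t \<in> sliding_manifold P i j \<and>
     ((\<forall>\<^sub>F s in at_left t. dif P i j (x s) < 0) \<and> (\<forall>\<^sub>F s in at_right t. dif P i j (x s) > 0) \<or>
      (\<forall>\<^sub>F s in at_left t. dif P i j (x s) > 0) \<and> (\<forall>\<^sub>F s in at_right t. dif P i j (x s) < 0))"

definition oscillates_indefinitely :: "params \<Rightarrow> (real \<Rightarrow> state) \<Rightarrow> bool" where
  "oscillates_indefinitely P x \<longleftrightarrow>
     (\<forall>T\<ge>0. \<exists>t>T. switch_time P x t) \<and>
     (\<forall>i j. i \<noteq> j \<longrightarrow> (\<forall>T\<ge>0. \<exists>t>T. crossing_time P i j x t))"

text \<open>
  A solution must exist, and every solution from the initial state must oscillate, so no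
  uniqueness result is presupposed.
\<close>

definition oscillating_states :: "params \<Rightarrow> state set" where
  "oscillating_states P =
     {x0 \<in> state_space P.
        (\<exists>x. fluid_solution P x \<and> x 0 = x0) \<and>
        (\<forall>x. fluid_solution P x \<and> x 0 = x0 \<longrightarrow> oscillates_indefinitely P x)}"

end

theory Submission
  imports Defs
begin

text \<open>
  Write \<open>i\<close> for the class that is being helped, \<open>j\<close> for the other class,
  \<open>D\<close> for the difference of the queue of \<open>i\<close> and the queue of \<open>j\<close>,
  \<open>y\<close> for the class-\<open>i\<close> fluid in pool \<open>j\<close> and \<open>w\<close> for the
  class-\<open>j\<close> fluid in pool \<open>i\<close>.

  The oscillation is caused by the fluid that the help leaves behind. While pool \<open>j\<close>
  helps, \<open>D\<close> decreases at a rate between about 1 and 2; if it starts well above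
  \<open>kappa\<close>, then pool \<open>j\<close> is mostly filled with class-\<open>i\<close> fluid by the time
  \<open>D\<close> has come down to \<open>kappa\<close>, whereas \<open>w\<close> has dropped below \<open>tau\<close>.
  Help now stops, but pool \<open>j\<close> serves the class-\<open>i\<close> fluid in it slowly, at rate
  \<open>mu\<close>, so it releases less capacity than pool \<open>i\<close>, and \<open>D\<close> keeps
  decreasing: \<open>D' = - theta D - (1 - mu) (y - w)\<close>. Help in the opposite direction is blocked
  while \<open>y > tau\<close>. As \<open>y\<close> decays at rate \<open>mu\<close>, the decrease of \<open>D\<close>
  up to the moment when \<open>y = tau\<close> is of order \<open>1 / mu\<close> if \<open>theta\<close> is much
  smaller than \<open>mu\<close>, so that \<open>D\<close> is far below \<open>- kappa\<close> when the block is
  lifted. At that moment help starts in the opposite direction from a state of the same kind, with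
  the two classes exchanged. For \<open>mu = 1/10\<close>, \<open>theta = 1/10000\<close>,
  \<open>kappa = 1/10\<close>, \<open>tau = 1/1024\<close> and \<open>lam = 1 - tau\<close> this argument is
  quantitative: a box of starting states is mapped into the same box with the classes
  exchanged, and no periodic orbit has to be found. The two halves of the cycle are
  \<open>sharing_phase\<close> and \<open>own_phase\<close>.

  The queues have to stay positive during the whole motion. With \<open>q\<^sub>i\<close> and
  \<open>q\<^sub>j\<close> for the two queues, this follows from
  \<open>E = q\<^sub>i + q\<^sub>j + (1 - mu) / mu * (y + w)\<close>, which counts with the fluid in
  queue the future loss of service capacity caused by the fluid that is in the wrong pool. Apart
  from abandonment, this quantity gains more in each sharing phase than it loses in the next phase,
  and since \<open>theta\<close> is tiny, the level at which abandonment would balance the gain is much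
  larger than \<open>|D|\<close>.

  Every solution from the initial state has to oscillate, although the right-hand side is
  discontinuous and only holds almost everywhere. The constructed solution is always in the
  interior of one regime, or at the start of sharing (\<open>w = tau\<close>, where \<open>w\<close> cannot
  grow), or at the end of sharing (\<open>D = kappa\<close>, where every admissible rate makes \<open>D\<close>
  decrease). In each of these states the regime of any solution on a short interval to the right is
  determined, hence so is the solution; this gives uniqueness (\<open>regular_solution_unique\<close>),
  and every solution is the constructed one.
\<close>

section \<open>Differential inequalities and linear differential equations\<close>

lemma exp_weighted_derivative:
  fixes g :: "real \<Rightarrow> real"
  assumes "(g has_real_derivative d) (at r)"
  shows "((\<lambda>t. exp (c * t) * g t) has_real_derivative exp (c * r) * (d + c * g r)) (at r)"
proof -
  have "((\<lambda>t. exp (c * t)) has_real_derivative exp (c * r) * c) (at r)"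
    by (auto intro!: derivative_eq_intros)
  from DERIV_mult[OF this assms] show ?thesis by (simp add: algebra_simps)
qed

text \<open>
  The function \<open>exp (c * t) * f t\<close> is nondecreasing. Comparisons of this kind replace
  explicit formulas for the queues everywhere below.
\<close>

lemma nonneg_of_growth_bound:
  fixes f :: "real \<Rightarrow> real"
  assumes f: "\<And>r. (f has_real_derivative f' r) (at r)"
    and ge: "\<And>r. r \<in> {0..b} \<Longrightarrow> - c * f r \<le> f' r"
    and init: "0 \<le> f 0" and t: "t \<in> {0..b}"
  shows "0 \<le> f t"
proof -
  have "exp (c * 0) * f 0 \<le> exp (c * t) * f t"
  proof (rule DERIV_nonneg_imp_nondecreasing[where f = "\<lambda>t. exp (c * t) * f t"])
    fix r assume "0 \<le> r" "r \<le> t"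
    then have "0 \<le> exp (c * r) * (f' r + c * f r)" using ge[of r] t by simp
    then show "\<exists>y. ((\<lambda>t. exp (c * t) * f t) has_real_derivative y) (at r) \<and> 0 \<le> y"
      using exp_weighted_derivative[OF f] by blast
  qed (use t in auto)
  then have "0 \<le> exp (c * t) * f t" using init by simp
  then show ?thesis by (simp add: zero_le_mult_iff)
qed

lemma pos_of_growth_bound:
  fixes f :: "real \<Rightarrow> real"
  assumes f: "\<And>r. (f has_real_derivative f' r) (at r)"
    and gt: "\<And>r. r \<in> {0..b} \<Longrightarrow> - c * f r < f' r"
    and init: "0 \<le> f 0" and t: "t \<in> {0<..b}"
  shows "0 < f t"
proof -
  have "exp (c * 0) * f 0 < exp (c * t) * f t"
  proof (rule DERIV_pos_imp_increasing[where f = "\<lambda>t. exp (c * t) * f t"])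
    fix r assume "0 \<le> r" "r \<le> t"
    then have "0 < exp (c * r) * (f' r + c * f r)" using gt[of r] t by simp
    then show "\<exists>y. ((\<lambda>t. exp (c * t) * f t) has_real_derivative y) (at r) \<and> 0 < y"
      using exp_weighted_derivative[OF f] by blast
  qed (use t in auto)
  then have "0 < exp (c * t) * f t" using init by simp
  then show ?thesis by (simp add: zero_less_mult_iff)
qed

lemma le_of_derivative_le:
  fixes f :: "real \<Rightarrow> real"
  assumes f: "\<And>r. (f has_real_derivative f' r) (at r)"
    and le: "\<And>r. r \<in> {0..b} \<Longrightarrow> f' r \<le> c" and t: "t \<in> {0..b}"
  shows "f t \<le> f 0 + c * t"
proof -
  have "0 \<le> f 0 + c * t - f t"
    by (rule nonneg_of_growth_bound[where f = "\<lambda>t. f 0 + c * t - f t" and c = 0 and f' = "\<lambda>r. c - f' r" and b = b])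
      (use le t in \<open>auto intro!: derivative_eq_intros f\<close>)
  then show ?thesis by simp
qed

text \<open>
  Variation of constants.
\<close>

lemma linear_ode_exists:
  fixes g :: "real \<Rightarrow> real"
  assumes g: "continuous_on UNIV g"
  obtains q where "q 0 = q0" "\<And>t. (q has_real_derivative g t - c * q t) (at t)"
proof -
  have "continuous_on UNIV (\<lambda>t. exp (c * t) * g t)" by (intro continuous_intros g)
  then have "\<And>t. isCont (\<lambda>t. exp (c * t) * g t) t" by (simp add: continuous_on_eq_continuous_at)
  then obtain F where F: "\<And>t. (F has_vector_derivative exp (c * t) * g t) (at t)"
    using einterval_antiderivative[of "- \<infinity>" \<infinity> "\<lambda>t. exp (c * t) * g t"] by auto
  define h where "h t = F t - F 0 + q0" for t
  have h: "(h has_real_derivative exp (c * t) * g t) (at t)" for t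
    unfolding h_def using F[of t]
    by (auto simp: has_real_derivative_iff_has_vector_derivative intro!: derivative_eq_intros)
  define q where "q t = exp (- c * t) * h t" for t
  show thesis
  proof (rule that)
    show "q 0 = q0" by (simp add: q_def h_def)
    show "(q has_real_derivative g t - c * q t) (at t)" for t
      using exp_weighted_derivative[OF h[of t], of "- c"]
      unfolding q_def by (simp add: algebra_simps flip: exp_add mult.assoc)
  qed
qed

lemma first_hitting_time:
  fixes f :: "real \<Rightarrow> real"
  assumes cont: "continuous_on {0..b} f" and "c < f 0" "f b \<le> c" "0 \<le> b"
  obtains a where "a \<in> {0<..b}" "f a = c" "\<And>t. t \<in> {0..<a} \<Longrightarrow> c < f t"
proof -
  define A where "A = {t \<in> {0..b}. f t = c}"
  have "closed A" unfolding A_def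
    using continuous_closed_preimage_constant[OF cont, of c] by simp
  then have "compact A"
    by (intro compact_eq_bounded_closed[THEN iffD2] conjI bounded_subset[OF bounded_closed_interval[of 0 b]])
      (auto simp: A_def)
  moreover obtain t where "t \<in> A"
    using IVT2'[of f b c 0] assms by (auto simp: A_def)
  ultimately obtain a where a: "a \<in> A" "\<And>t. t \<in> A \<Longrightarrow> a \<le> t"
    using compact_attains_inf[of A] by blast
  show thesis
  proof (rule that)
    show "a \<in> {0<..b}" using a(1) assms by (cases "a = 0") (auto simp: A_def)
    show "f a = c" using a(1) by (simp add: A_def)
    fix t assume t: "t \<in> {0..<a}"
    show "c < f t"
    proof (rule ccontr)
      assume "\<not> c < f t"
      moreover have "continuous_on {0..t} f"
        by (rule continuous_on_subset[OF cont]) (use t a(1) in \<open>auto simp: A_def\<close>)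
      ultimately obtain r where "0 \<le> r" "r \<le> t" "f r = c"
        using IVT2'[of f t c 0] assms t by auto
      then have "r \<in> A" using t a(1) by (auto simp: A_def)
      then show False using a(2)[of r] t \<open>r \<le> t\<close> by auto
    qed
  qed
qed


lemma affine_lipschitz:
  fixes F :: "'a::euclidean_space \<Rightarrow> 'b::real_normed_vector"
  assumes "linear (\<lambda>x. F x - F 0)"
  obtains K where "\<And>x y. norm (F x - F y) \<le> K * norm (x - y)"
proof -
  obtain K where "\<And>x. norm (F x - F 0) \<le> K * norm x"
    using linear_bounded[OF assms] by auto
  moreover have "F x - F y = F (x - y) - F 0" for x y
    using linear_diff[OF assms, of x y] by simp
  ultimately show thesis using that by metis
qed

text \<open>
  By the Lipschitz bound, \<open>exp (- 2 * K * t)\<close> times the squared distance of the two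
  solutions is nonincreasing. The equation is only required in the open interval, since at the left
  end the solutions of the fluid model need not be differentiable.
\<close>

lemma ode_unique:
  fixes x y :: "real \<Rightarrow> 'a::euclidean_space"
  assumes lip: "\<And>a b. norm (F a - F b) \<le> K * norm (a - b)"
    and cont: "continuous_on {s..e} x" "continuous_on {s..e} y"
    and x: "\<And>t. t \<in> {s<..<e} \<Longrightarrow> (x has_vector_derivative F (x t)) (at t)"
    and y: "\<And>t. t \<in> {s<..<e} \<Longrightarrow> (y has_vector_derivative F (y t)) (at t)"
    and init: "x s = y s" and t: "t \<in> {s..e}"
  shows "x t = y t"
proof -
  define n where "n t = exp (- 2 * K * t) * ((x t - y t) \<bullet> (x t - y t))" for t
  have n_deriv: "\<exists>d. (n has_real_derivative d) (at r) \<and> d \<le> 0" if r: "r \<in> {s<..<e}" for r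
  proof -
    let ?w = "x r - y r" and ?d = "F (x r) - F (y r)"
    have "((\<lambda>t. x t - y t) has_derivative (\<lambda>h. h *\<^sub>R ?d)) (at r)"
      using has_vector_derivative_diff[OF x[OF r] y[OF r]] by (simp add: has_vector_derivative_def)
    from has_derivative_inner[OF this this]
    have "((\<lambda>t. (x t - y t) \<bullet> (x t - y t)) has_real_derivative 2 * (?w \<bullet> ?d)) (at r)"
      by (simp add: has_field_derivative_def inner_commute mult_ac mult_commute_abs)
    from exp_weighted_derivative[OF this, of "- 2 * K"]
    have "(n has_real_derivative
        exp (- 2 * K * r) * (2 * (?w \<bullet> ?d) - 2 * K * (?w \<bullet> ?w))) (at r)"
      unfolding n_def by simp
    moreover have "?w \<bullet> ?d \<le> K * (?w \<bullet> ?w)"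
    proof -
      have "?w \<bullet> ?d \<le> norm ?w * norm ?d" by (rule norm_cauchy_schwarz)
      also have "\<dots> \<le> norm ?w * (K * norm ?w)"
        using lip[of "x r" "y r"] by (intro mult_left_mono) auto
      finally show ?thesis by (simp add: dot_square_norm power2_eq_square mult_ac)
    qed
    ultimately show ?thesis
      by (auto intro!: exI mult_nonneg_nonpos)
  qed
  have "n t \<le> n s"
  proof (rule DERIV_nonpos_imp_decreasing_open[where f = n and a = s and b = t])
    show "continuous_on {s..t} n"
      unfolding n_def using t
      by (intro continuous_intros continuous_on_subset[OF cont(1)] continuous_on_subset[OF cont(2)]) auto
  qed (use t n_deriv in auto)
  then have "n t \<le> 0" using init by (simp add: n_def)
  then have "(norm (x t - y t))\<^sup>2 \<le> 0"
    by (simp add: n_def mult_le_0_iff power2_norm_eq_inner)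
  then show ?thesis by simp
qed

lemma has_vector_derivative_vecI:
  fixes f :: "real \<Rightarrow> 'a::euclidean_space ^ 'n"
  assumes "\<And>k. ((\<lambda>t. f t $ k) has_vector_derivative f' $ k) (at a within S)"
  shows "(f has_vector_derivative f') (at a within S)"
  unfolding has_vector_derivative_def
proof (rule has_derivative_componentwise_within[THEN iffD2, rule_format])
  fix b :: "'a ^ 'n" assume "b \<in> Basis"
  then obtain k e where b: "b = axis k e" by (auto simp: Basis_vec_def)
  have "((\<lambda>t. f t $ k \<bullet> e) has_derivative (\<lambda>h. (h *\<^sub>R f' $ k) \<bullet> e)) (at a within S)"
    by (rule bounded_linear.has_derivative[OF bounded_linear_inner_left])
      (use assms[of k] in \<open>simp add: has_vector_derivative_def\<close>)
  then show "((\<lambda>t. f t \<bullet> b) has_derivative (\<lambda>h. (h *\<^sub>R f') \<bullet> b)) (at a within S)"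
    by (simp add: b inner_axis)
qed

lemma has_vector_derivative_shift:
  assumes "(f has_vector_derivative v) (at (t - s))"
  shows "((\<lambda>t. f (t - s)) has_vector_derivative v) (at (t::real))"
proof -
  have "((\<lambda>t. t - s) has_real_derivative 1) (at t)" by (auto intro!: derivative_eq_intros)
  from vector_diff_chain_at[OF this[unfolded has_real_derivative_iff_has_vector_derivative] assms]
  show ?thesis by (simp add: o_def)
qed

section \<open>Allocations and velocities with positive queues\<close>

definition sharing_rates :: "params \<Rightarrow> 2 \<Rightarrow> state \<Rightarrow> real ^ 2 ^ 2" where
  "sharing_rates P i x = (\<chi> k l. if k = i then released P x l else 0)"

definition own_rates :: "params \<Rightarrow> state \<Rightarrow> real ^ 2 ^ 2" where
  "own_rates P x = (\<chi> k l. if k = l then released P x l else 0)"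

definition sharing_field :: "params \<Rightarrow> 2 \<Rightarrow> state \<Rightarrow> state" where
  "sharing_field P i x = velocity P x (sharing_rates P i x)"

definition own_field :: "params \<Rightarrow> state \<Rightarrow> state" where
  "own_field P x = velocity P x (own_rates P x)"

definition positive_queues :: "state \<Rightarrow> bool" where
  "positive_queues x \<longleftrightarrow> (\<forall>k. queue x k > 0)"

definition sharing_states :: "params \<Rightarrow> 2 \<Rightarrow> 2 \<Rightarrow> state set" where
  "sharing_states P i j = {x \<in> active_sharing P i j. positive_queues x}"

text \<open>
  States at which sharing ends. The inequality makes pool \<open>i\<close> release more capacity than
  pool \<open>j\<close>, so no split of the capacity of pool \<open>j\<close> keeps the difference of the
  queues at \<open>kappa\<close>, and the sliding manifold is left at once.
\<close>

definition exit_states :: "params \<Rightarrow> 2 \<Rightarrow> 2 \<Rightarrow> state set" where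
  "exit_states P i j =
     {x \<in> sliding_manifold P i j. positive_queues x \<and> serv x j i < serv x i j}"

text \<open>
  States after sharing in the direction of \<open>(i, j)\<close>, where help in the opposite direction
  is blocked by the threshold \<open>kappa\<close> or by the fluid left in pool \<open>j\<close>.
\<close>

definition own_states :: "params \<Rightarrow> 2 \<Rightarrow> 2 \<Rightarrow> state set" where
  "own_states P i j =
     {x \<in> state_space P. both_full x \<and> positive_queues x \<and> dif P i j x < 0 \<and>
        (dif P j i x < 0 \<or> serv x i j > tau P)}"

lemma pair_cases:
  fixes i j :: 2
  assumes "i \<noteq> j"
  obtains "i = 1" "j = 2" | "i = 2" "j = 1"
  using assms exhaust_2 by metis

lemma full_pair: "i \<noteq> j \<Longrightarrow> full x k \<longleftrightarrow> serv x i k + serv x j k = 1"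
  by (erule pair_cases) (auto simp: full_def)

lemma released_own:
  assumes "i \<noteq> j" "full x j"
  shows "released P x j = 1 - (1 - mu P) * serv x i j"
  using assms
  by (elim pair_cases) (auto simp: full_def released_def service_rate_def algebra_simps)

lemma released_nonneg:
  assumes "standing_assumptions P" "x \<in> state_space P"
  shows "0 \<le> released P x j"
  using assms unfolding released_def service_rate_def standing_assumptions_def state_space_def
  by simp

lemma queue_velocity_pair:
  assumes "i \<noteq> j"
  shows "queue (velocity P x u) k = lam P - theta P * queue x k - (u $ k $ i + u $ k $ j)"
  using assms by (elim pair_cases) (auto simp: velocity_def)

lemma serv_velocity:
  "serv (velocity P x u) k l = u $ k $ l - service_rate P k l * serv x k l"
  by (simp add: velocity_def)

lemma all_pair: "(i::2) \<noteq> j \<Longrightarrow> (\<forall>k. Q k) \<longleftrightarrow> Q i \<and> Q j"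
  by (erule pair_cases) (auto simp: forall_2)

text \<open>
  As \<open>kappa > 0\<close>, sharing in one direction excludes sharing and sliding in the other
  one.
\<close>

lemma admissible_sharing_iff:
  assumes "standing_assumptions P" "i \<noteq> j" "x \<in> active_sharing P i j"
  shows "admissible P x u \<longleftrightarrow> u = sharing_rates P i x"
proof -
  have k: "kappa P > 0"
    using assms(1) by (simp add: standing_assumptions_def)
  have "dif P j i x < 0" "dif P i j x > 0"
    using assms(3) k by (auto simp: active_sharing_def dif_def)
  then have out: "x \<notin> active_sharing P j i" "x \<notin> sliding P j i" "x \<notin> sliding P i j"
    by (auto simp: active_sharing_def sliding_def sliding_manifold_def)
  have "admissible P x u \<longleftrightarrow> sharing_alloc P i j x u"
    using assms(2,3) out unfolding admissible_def all_pair[OF assms(2)] by auto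
  also have "\<dots> \<longleftrightarrow> u = sharing_rates P i x"
    using assms(2) unfolding sharing_alloc_def sharing_rates_def vec_eq_iff all_pair[OF assms(2)]
    by auto
  finally show ?thesis .
qed

text \<open>
  A pool whose own queue is positive has no spare capacity, so nothing flows across.
\<close>

lemma admissible_own_iff:
  assumes "i \<noteq> j" "positive_queues x"
    "x \<notin> active_sharing P i j" "x \<notin> active_sharing P j i"
    "x \<notin> sliding P i j" "x \<notin> sliding P j i"
  shows "admissible P x u \<longleftrightarrow> u = own_rates P x"
proof -
  have q: "queue x i > 0" "queue x j > 0"
    using assms(2) by (auto simp: positive_queues_def)
  then have ns: "\<not> spare P x i" "\<not> spare P x j"
    by (auto simp: spare_def)
  have "admissible P x u \<longleftrightarrow> own_alloc P i j x u \<and> own_alloc P j i x u"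
    using assms(1,3-) unfolding admissible_def all_pair[OF assms(1)] by auto
  also have "\<dots> \<longleftrightarrow> u = own_rates P x"
    using assms(1) q ns unfolding own_alloc_def own_rates_def vec_eq_iff all_pair[OF assms(1)]
    by auto
  finally show ?thesis .
qed

lemma admissible_own_states_iff:
  assumes "standing_assumptions P" "i \<noteq> j" "x \<in> own_states P i j"
  shows "admissible P x u \<longleftrightarrow> u = own_rates P x"
proof (rule admissible_own_iff[OF assms(2)])
  show "positive_queues x" using assms(3) by (simp add: own_states_def)
qed (use assms(3) in \<open>auto simp: own_states_def active_sharing_def sliding_def sliding_manifold_def\<close>)

lemma field_affine:
  "linear (\<lambda>x. sharing_field P i x - sharing_field P i 0)"
  "linear (\<lambda>x. own_field P x - own_field P 0)"
  unfolding sharing_field_def own_field_def velocity_def sharing_rates_def own_rates_def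
    released_def linear_iff prod_eq_iff vec_eq_iff
  by (auto simp: algebra_simps)

section \<open>Solutions as integrals of their rates\<close>

lemma solution_continuous:
  assumes "fluid_solution P x" "0 \<le> s"
  shows "continuous_on {s..e} x"
proof (rule continuous_on_subset)
  show "continuous_on {0..} x" using assms(1) by (simp add: fluid_solution_def)
qed (use assms(2) in auto)

lemma fluid_solution_rates:
  assumes "fluid_solution P x"
  obtains v N where "negligible N"
    "\<And>s t. 0 \<le> s \<Longrightarrow> s \<le> t \<Longrightarrow> (v has_integral (x t - x s)) {s..t}"
    "\<And>t. t > 0 \<Longrightarrow> t \<notin> N \<Longrightarrow> \<exists>u. admissible P (x t) u \<and> v t = velocity P (x t) u"
proof -
  obtain v N where vN: "negligible N" "\<forall>t\<ge>0. (v has_integral (x t - x 0)) {0..t}"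
    "\<forall>t>0. t \<notin> N \<longrightarrow> (\<exists>u. admissible P (x t) u \<and> v t = velocity P (x t) u)"
    using assms unfolding fluid_solution_def by metis
  have "(v has_integral (x t - x s)) {s..t}" if "0 \<le> s" "s \<le> t" for s t
  proof -
    have "v integrable_on {0..t}" using vN(2) that by (meson has_integral_integrable order_trans)
    then have "v integrable_on {s..t}"
      by (rule integrable_on_subinterval) (use that in auto)
    then obtain j where j: "(v has_integral j) {s..t}" by blast
    have "(v has_integral (x s - x 0) + j) {0..t}"
      using that vN(2) j by (intro has_integral_combine[of 0 s t]) auto
    then have "(x s - x 0) + j = x t - x 0"
      using vN(2) that by (meson has_integral_unique order_trans)
    then have "j = x t - x s" by (simp add: algebra_simps)
    then show ?thesis using j by simp
  qed
  with vN show thesis using that by blast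
qed

text \<open>
  A bound for the rate of a linear functional can be integrated although it is known only almost
  everywhere.
\<close>

lemma solution_functional_le:
  fixes g :: "state \<Rightarrow> real"
  assumes sol: "fluid_solution P x" and g: "bounded_linear g" and st: "0 \<le> s" "s \<le> t"
    and le: "\<And>r u. r \<in> {s<..<t} \<Longrightarrow> admissible P (x r) u \<Longrightarrow> g (velocity P (x r) u) \<le> c"
  shows "g (x t) - g (x s) \<le> c * (t - s)"
proof -
  obtain v N where v: "negligible N" "(v has_integral (x t - x s)) {s..t}"
    "\<And>t. t > 0 \<Longrightarrow> t \<notin> N \<Longrightarrow> \<exists>u. admissible P (x t) u \<and> v t = velocity P (x t) u"
    using fluid_solution_rates[OF sol] st by metis
  define h where "h r = (if r \<in> N \<union> {s, t} then c else g (v r))" for r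
  have "((g \<circ> v) has_integral g (x t - x s)) {s..t}"
    by (rule has_integral_linear[OF v(2) g])
  then have "(h has_integral g (x t - x s)) {s..t}"
    by (rule has_integral_spike[rotated 2, where S = "N \<union> {s, t}"])
       (use v(1) in \<open>auto simp: h_def intro!: negligible_Un\<close>)
  moreover have "((\<lambda>r. c) has_integral c * (t - s)) {s..t}"
    using has_integral_const_real[of c s t] st by (simp add: mult.commute)
  moreover have "h r \<le> c" if "r \<in> {s..t}" for r
    using that v(3)[of r] le[of r] st by (auto simp: h_def)
  ultimately have "g (x t - x s) \<le> c * (t - s)"
    by (rule has_integral_le)
  then show ?thesis
    by (simp add: linear_diff[OF bounded_linear.linear[OF g]])
qed

text \<open>
  Where the admissible rates are a continuous function of the state, the exceptional null set
  disappears: the solution is the integral of a continuous function there.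
\<close>

lemma solution_has_derivative:
  assumes sol: "fluid_solution P x" and F: "continuous_on UNIV F" and s: "0 \<le> s"
    and eq: "\<And>r u. r \<in> {s<..<e} \<Longrightarrow> admissible P (x r) u \<Longrightarrow> velocity P (x r) u = F (x r)"
    and r: "r \<in> {s<..<e}"
  shows "(x has_vector_derivative F (x r)) (at r)"
proof -
  obtain v N where v: "negligible N"
    "\<And>s t. 0 \<le> s \<Longrightarrow> s \<le> t \<Longrightarrow> (v has_integral (x t - x s)) {s..t}"
    "\<And>t. t > 0 \<Longrightarrow> t \<notin> N \<Longrightarrow> \<exists>u. admissible P (x t) u \<and> v t = velocity P (x t) u"
    using fluid_solution_rates[OF sol] by metis
  have cont: "continuous_on {s..e} (\<lambda>t. F (x t))"
    by (rule continuous_on_compose2[OF F solution_continuous[OF sol s]]) auto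
  have int: "((\<lambda>t. F (x t)) has_integral (x t - x s)) {s..t}" if "t \<in> {s..e}" for t
  proof (rule has_integral_spike[where S = "N \<union> {s, e}" and f = v])
    show "negligible (N \<union> {s, e})" using v(1) by (auto intro!: negligible_Un)
    show "(v has_integral (x t - x s)) {s..t}" using v(2) that s by auto
  next
    fix q assume "q \<in> {s..t} - (N \<union> {s, e})"
    then show "F (x q) = v q" using v(3)[of q] eq[of q] that s by auto
  qed
  have "((\<lambda>t. integral {s..t} (\<lambda>t. F (x t))) has_vector_derivative F (x r)) (at r within {s..e})"
    using cont r by (intro integral_has_vector_derivative) auto
  then have "((\<lambda>t. x t - x s) has_vector_derivative F (x r)) (at r within {s..e})"
    by (rule has_vector_derivative_transform[rotated 2])
       (use r in \<open>auto simp: integral_unique[OF int]\<close>)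
  from has_vector_derivative_add_const[THEN iffD1, of "\<lambda>t. x t" "- x s"] this
  have "(x has_vector_derivative F (x r)) (at r within {s..e})" by simp
  then show ?thesis using r by (simp add: at_within_Icc_at)
qed

lemma solutions_agree:
  assumes sol: "fluid_solution P x" "fluid_solution P y" and s: "0 \<le> s" and init: "x s = y s"
    and lin: "linear (\<lambda>z. F z - F 0)"
    and eq: "\<And>r u. r \<in> {s<..<e} \<Longrightarrow> admissible P (x r) u \<Longrightarrow> velocity P (x r) u = F (x r)"
      "\<And>r u. r \<in> {s<..<e} \<Longrightarrow> admissible P (y r) u \<Longrightarrow> velocity P (y r) u = F (y r)"
    and t: "t \<in> {s..e}"
  shows "x t = y t"
proof -
  have "continuous_on UNIV (\<lambda>z. (F z - F 0) + F 0)"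
    using lin by (intro continuous_on_add continuous_on_const linear_continuous_on)
      (simp add: linear_conv_bounded_linear)
  then have F: "continuous_on UNIV F" by simp
  obtain K where K: "\<And>a b. norm (F a - F b) \<le> K * norm (a - b)"
    using affine_lipschitz[OF lin] by metis
  note c = solution_continuous[OF sol(1) s, of e] solution_continuous[OF sol(2) s, of e]
  show ?thesis
    by (rule ode_unique[OF K c _ _ init t])
      (use solution_has_derivative[OF sol(1) F s eq(1)] solution_has_derivative[OF sol(2) F s eq(2)]
        in auto)
qed

lemma solution_stays_nearby:
  assumes "fluid_solution P x" "open G" "x s \<in> G" "0 \<le> s"
  obtains d where "d > 0" "\<And>t. t \<in> {s..s + d} \<Longrightarrow> x t \<in> G"
proof -
  have "continuous (at s within {0..}) x"
    using assms by (auto simp: fluid_solution_def continuous_on_eq_continuous_within)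
  then have "\<forall>\<^sub>F t in at s within {0..}. x t \<in> G"
    using assms by (auto simp: continuous_within topological_tendstoD)
  then obtain e where e: "e > 0" "\<forall>t\<in>{0..}. t \<noteq> s \<and> dist t s < e \<longrightarrow> x t \<in> G"
    unfolding eventually_at by blast
  have "x t \<in> G" if "t \<in> {s..s + e / 2}" for t
    using that e assms(3,4) by (cases "t = s") (auto simp: dist_real_def)
  then show thesis using e(1) by (intro that[of "e / 2"]) auto
qed

lemma open_queues: "open {x. positive_queues x}"
proof -
  have "{x. positive_queues x} = (\<Inter>k. {x. 0 < queue x k})" by (auto simp: positive_queues_def)
  then show ?thesis by (auto intro!: open_INT open_Collect_less continuous_intros)
qed

lemma continuous_dif: "continuous_on UNIV (dif P i j)"
  unfolding dif_def by (intro continuous_intros)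

lemma open_serv: "open {x. c < serv x k l}" "open {x. serv x k l < serv x k' l'}"
  by (intro open_Collect_less continuous_intros)+

lemma open_dif: "open {x. c < dif P i j x}" "open {x. dif P i j x < c}"
  by (intro open_Collect_less continuous_on_const continuous_dif)+

lemma solution_full:
  assumes "fluid_solution P x" "0 \<le> t" "positive_queues (x t)"
  shows "x t \<in> state_space P" "both_full (x t)"
  using assms by (auto simp: fluid_solution_def non_idling_def positive_queues_def both_full_def)

section \<open>Uniqueness to the right of regular states\<close>

text \<open>
  At the start of sharing \<open>serv x j i\<close> may be equal to \<open>tau\<close>, on the boundary
  between two regimes. In both of them no class-\<open>j\<close> fluid enters pool \<open>i\<close>, so
  \<open>serv x j i\<close> does not increase, and the solution stays in the sharing regime.
\<close>

lemma sharing_agree: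
  assumes P: "standing_assumptions P" and ij: "i \<noteq> j"
    and sol: "fluid_solution P x" "fluid_solution P y" and s: "0 \<le> s"
    and eq: "x s = y s" and st: "x s \<in> sharing_states P i j"
  obtains d where "d > 0" "\<And>t. t \<in> {s..s + d} \<Longrightarrow> x t = y t"
proof -
  define G where "G = {z. positive_queues z} \<inter> {z. 0 < dif P i j z}"
  have G: "open G" unfolding G_def by (intro open_Int open_queues open_dif)
  have *: "\<exists>d>0. \<forall>t\<in>{s..s + d}. z t \<in> sharing_states P i j"
    if z: "fluid_solution P z" and zs: "z s \<in> sharing_states P i j" for z
  proof -
    have "z s \<in> G" using zs by (auto simp: G_def sharing_states_def active_sharing_def)
    from solution_stays_nearby[OF z G this s] obtain d where
      d: "d > 0" "\<And>t. t \<in> {s..s + d} \<Longrightarrow> z t \<in> G" by metis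
    have "z t \<in> sharing_states P i j" if t: "t \<in> {s..s + d}" for t
    proof -
      have "serv (z t) j i - serv (z s) j i \<le> 0 * (t - s)"
      proof (rule solution_functional_le[OF z, where g = "\<lambda>z. serv z j i"])
        show "bounded_linear (\<lambda>z::state. serv z j i)"
          by (intro bounded_linear_compose[OF bounded_linear_vec_nth]
              bounded_linear_compose[OF bounded_linear_vec_nth bounded_linear_snd])
      next
        fix r u assume r: "r \<in> {s<..<t}" and u: "admissible P (z r) u"
        have zr: "z r \<in> G" "z r \<in> state_space P" "both_full (z r)"
          using d(2)[of r] r t s solution_full[OF z, of r] by (auto simp: G_def)
        have "u $ j $ i = 0"
        proof (cases "z r \<in> active_sharing P i j")
          case True
          then show ?thesis using admissible_sharing_iff[OF P ij] u ij by (simp add: sharing_rates_def)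
        next
          case False
          have "dif P j i (z r) < 0" "dif P i j (z r) > 0"
            using zr(1) P by (auto simp: G_def dif_def standing_assumptions_def)
          then have "u = own_rates P (z r)"
            using False zr ij u by (intro admissible_own_iff[OF ij, THEN iffD1])
              (auto simp: G_def active_sharing_def sliding_def sliding_manifold_def)
          then show ?thesis using ij by (simp add: own_rates_def)
        qed
        then show "serv (velocity P (z r) u) j i \<le> 0"
          using zr(2) P by (auto simp: serv_velocity service_rate_def state_space_def
              standing_assumptions_def)
      qed (use s t in auto)
      moreover have "serv (z s) j i \<le> tau P"
        using zs by (auto simp: sharing_states_def active_sharing_def)
      ultimately show ?thesis
        using d(2)[OF t] solution_full[OF z, of t] t s
        by (auto simp: G_def sharing_states_def active_sharing_def)
    qed
    then show ?thesis using d(1) by blast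
  qed
  obtain d d' where d: "d > 0" "d' > 0" "\<forall>t\<in>{s..s + d}. x t \<in> sharing_states P i j"
    "\<forall>t\<in>{s..s + d'}. y t \<in> sharing_states P i j"
    using *[OF sol(1)] *[OF sol(2)] st eq by metis
  have v: "velocity P z u = sharing_field P i z" if "z \<in> sharing_states P i j" "admissible P z u" for z u
    using that admissible_sharing_iff[OF P ij] by (auto simp: sharing_states_def sharing_field_def)
  show thesis
  proof (rule that)
    show "min d d' > 0" using d by simp
    fix t assume t: "t \<in> {s..s + min d d'}"
    show "x t = y t"
    proof (rule solutions_agree[OF sol s eq field_affine(1)[of P i] _ _ t])
      fix r u assume r: "r \<in> {s<..<s + min d d'}"
      then have "x r \<in> sharing_states P i j" "y r \<in> sharing_states P i j" using d by auto
      then show "admissible P (x r) u \<Longrightarrow> velocity P (x r) u = sharing_field P i (x r)"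
        "admissible P (y r) u \<Longrightarrow> velocity P (y r) u = sharing_field P i (y r)"
        using v by blast+
    qed
  qed
qed

lemma own_agree:
  assumes P: "standing_assumptions P" and ij: "i \<noteq> j"
    and sol: "fluid_solution P x" "fluid_solution P y" and s: "0 \<le> s" and eq: "x s = y s"
    and d: "d > 0" "\<And>t. t \<in> {s<..<s + d} \<Longrightarrow> x t \<in> own_states P i j"
    and d': "d' > 0" "\<And>t. t \<in> {s<..<s + d'} \<Longrightarrow> y t \<in> own_states P i j"
  obtains e where "e > 0" "\<And>t. t \<in> {s..s + e} \<Longrightarrow> x t = y t"
proof (rule that)
  show "min d d' > 0" using d d' by simp
  fix t assume t: "t \<in> {s..s + min d d'}"
  show "x t = y t"
  proof (rule solutions_agree[OF sol s eq field_affine(2)[of P] _ _ t])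
    fix r u assume r: "r \<in> {s<..<s + min d d'}"
    then have "x r \<in> own_states P i j" "y r \<in> own_states P i j" using d d' by auto
    then show "admissible P (x r) u \<Longrightarrow> velocity P (x r) u = own_field P (x r)"
      "admissible P (y r) u \<Longrightarrow> velocity P (y r) u = own_field P (y r)"
      using admissible_own_states_iff[OF P ij] by (auto simp only: own_field_def)
  qed
qed

text \<open>
  Close to the manifold every regime that can occur makes the difference of the queues
  decrease at a rate bounded away from zero: sharing, because both pools serve class \<open>i\<close>;
  sliding and no sharing, because pool \<open>i\<close> releases more capacity than pool \<open>j\<close>.
  So the solution cannot stay on the manifold.
\<close>

lemma exit_to_own:
  assumes P: "standing_assumptions P" and ij: "i \<noteq> j"
    and x: "fluid_solution P x" and s: "0 \<le> s" and st: "x s \<in> exit_states P i j"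
  obtains d where "d > 0" "\<And>t. t \<in> {s<..<s + d} \<Longrightarrow> x t \<in> own_states P i j"
proof -
  have P': "theta P > 0" "kappa P > 0" "mu P < 1" using P by (auto simp: standing_assumptions_def)
  define G where "G = {z. positive_queues z} \<inter> {z. serv z j i < serv z i j}
    \<inter> {z. - kappa P / 2 < dif P i j z}"
  have G: "open G" unfolding G_def by (intro open_Int open_queues open_dif open_serv)
  have "x s \<in> G"
    using st P' by (auto simp: G_def exit_states_def sliding_manifold_def)
  from solution_stays_nearby[OF x G this s] obtain d where
    d: "d > 0" "\<And>t. t \<in> {s..s + d} \<Longrightarrow> x t \<in> G" by metis
  have "x t \<in> own_states P i j" if t: "t \<in> {s<..<s + d}" for t
  proof -
    have "(queue (x t) i - queue (x t) j) - (queue (x s) i - queue (x s) j)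
        \<le> - theta P * kappa P / 2 * (t - s)"
    proof (rule solution_functional_le[OF x, where g = "\<lambda>z. queue z i - queue z j"])
      show "bounded_linear (\<lambda>z::state. queue z i - queue z j)"
        by (intro bounded_linear_sub bounded_linear_compose[OF bounded_linear_vec_nth bounded_linear_fst])
    next
      fix r u assume r: "r \<in> {s<..<t}" and u: "admissible P (x r) u"
      have z: "x r \<in> G" "x r \<in> state_space P" "both_full (x r)"
        using d(2)[of r] r t s solution_full[OF x, of r] by (auto simp: G_def)
      have out: "x r \<notin> active_sharing P j i" "x r \<notin> sliding P j i"
        using z(1) P' by (auto simp: G_def dif_def active_sharing_def sliding_def sliding_manifold_def)
      have fl: "full (x r) i" "full (x r) j" using z(3) by (auto simp: both_full_def)
      have "released P (x r) j < released P (x r) i"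
        using released_own[OF ij fl(2)] released_own[OF ij[symmetric] fl(1)] z(1) P'
        by (simp add: G_def)
      moreover have "0 \<le> released P (x r) j" using released_nonneg[OF P z(2)] .
      \<comment> \<open>The rate of the difference of the queues, apart from abandonment, in each regime that is possible here.\<close>
      moreover have "(u $ j $ i + u $ j $ j) - (u $ i $ i + u $ i $ j)
          \<le> max (released P (x r) j - released P (x r) i) (- released P (x r) i)"
      proof -
        consider "x r \<in> active_sharing P i j" | "x r \<in> sliding P i j"
          | "x r \<notin> active_sharing P i j" "x r \<notin> sliding P i j" by blast
        then show ?thesis
        proof cases
          case 1
          then have "u = sharing_rates P i (x r)" using admissible_sharing_iff[OF P ij] u by blast
          then show ?thesis
            using ij \<open>0 \<le> released P (x r) j\<close> by (simp add: sharing_rates_def)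
        next
          case 2
          then have "split_alloc P i j (x r) u"
            using u ij by (auto simp: admissible_def sliding_alloc_def)
          then show ?thesis by (auto simp: split_alloc_def)
        next
          case 3
          then have "u = own_rates P (x r)"
            using admissible_own_iff[OF ij _ 3(1) out(1) 3(2) out(2)] u z(1) by (auto simp: G_def)
          then show ?thesis using ij by (simp add: own_rates_def)
        qed
      qed
      moreover have "theta P * (kappa P / 2) \<le> theta P * (queue (x r) i - queue (x r) j)"
        using z(1) P' by (intro mult_left_mono) (auto simp: G_def dif_def)
      ultimately show "queue (velocity P (x r) u) i - queue (velocity P (x r) u) j
          \<le> - theta P * kappa P / 2"
        unfolding queue_velocity_pair[OF ij] by (simp add: algebra_simps max_def split: if_splits)
    qed (use s t in auto)
    moreover have "- theta P * kappa P / 2 * (t - s) < 0"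
      using P' t by simp
    moreover have "queue (x s) i - queue (x s) j = kappa P"
      using st by (simp add: exit_states_def sliding_manifold_def dif_def)
    ultimately have "dif P i j (x t) < 0" by (simp add: dif_def)
    moreover have "x t \<in> G" using d(2)[of t] t by simp
    ultimately show ?thesis
      using solution_full[OF x, of t] t s P' by (auto simp: own_states_def G_def dif_def)
  qed
  then show thesis using that d(1) by metis
qed

lemma own_persists:
  assumes P: "standing_assumptions P" and ij: "i \<noteq> j"
    and x: "fluid_solution P x" and s: "0 \<le> s" and st: "x s \<in> own_states P i j"
  obtains d where "d > 0" "\<And>t. t \<in> {s<..<s + d} \<Longrightarrow> x t \<in> own_states P i j"
proof -
  define G where "G = {z. positive_queues z} \<inter> {z. dif P i j z < 0} \<inter>
    ({z. dif P j i z < 0} \<union> {z. tau P < serv z i j})"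
  have G: "open G" unfolding G_def by (intro open_Int open_Un open_queues open_dif open_serv)
  have "x s \<in> G" using st by (auto simp: G_def own_states_def)
  from solution_stays_nearby[OF x G this s] obtain d where
    d: "d > 0" "\<And>t. t \<in> {s..s + d} \<Longrightarrow> x t \<in> G" by metis
  have "x t \<in> own_states P i j" if t: "t \<in> {s<..<s + d}" for t
    using d(2)[of t] solution_full[OF x, of t] t s by (auto simp: own_states_def G_def)
  then show thesis using that d(1) by metis
qed

definition regular_states :: "params \<Rightarrow> state set" where
  "regular_states P =
     (\<Union>(i, j)\<in>{(i, j). i \<noteq> j}. sharing_states P i j \<union> exit_states P i j \<union> own_states P i j)"

lemma regular_agree:
  assumes P: "standing_assumptions P"
    and sol: "fluid_solution P x" "fluid_solution P y" and s: "0 \<le> s"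
    and eq: "x s = y s" and st: "x s \<in> regular_states P"
  obtains d where "d > 0" "\<And>t. t \<in> {s..s + d} \<Longrightarrow> x t = y t"
proof -
  obtain i j where ij: "i \<noteq> j"
    and "x s \<in> sharing_states P i j \<or> x s \<in> exit_states P i j \<or> x s \<in> own_states P i j"
    using st by (auto simp: regular_states_def)
  then consider "x s \<in> sharing_states P i j" | "x s \<in> exit_states P i j" | "x s \<in> own_states P i j"
    by blast
  then show thesis
  proof cases
    case 1
    show ?thesis using sharing_agree[OF P ij sol s eq 1] that by blast
  next
    case 2
    then have y2: "y s \<in> exit_states P i j" using eq by simp
    obtain d where d: "d > 0" "\<And>t. t \<in> {s<..<s + d} \<Longrightarrow> x t \<in> own_states P i j"
      using exit_to_own[OF P ij sol(1) s 2] by blast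
    obtain d' where d': "d' > 0" "\<And>t. t \<in> {s<..<s + d'} \<Longrightarrow> y t \<in> own_states P i j"
      using exit_to_own[OF P ij sol(2) s y2] by blast
    show ?thesis using own_agree[OF P ij sol s eq d d'] that by blast
  next
    case 3
    then have y3: "y s \<in> own_states P i j" using eq by simp
    obtain d where d: "d > 0" "\<And>t. t \<in> {s<..<s + d} \<Longrightarrow> x t \<in> own_states P i j"
      using own_persists[OF P ij sol(1) s 3] by blast
    obtain d' where d': "d' > 0" "\<And>t. t \<in> {s<..<s + d'} \<Longrightarrow> y t \<in> own_states P i j"
      using own_persists[OF P ij sol(2) s y3] by blast
    show ?thesis using own_agree[OF P ij sol s eq d d'] that by blast
  qed
qed

text \<open>
  At the first time after which the solutions differ they still agree by continuity, and then
  they agree a little longer.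
\<close>

lemma regular_solution_unique:
  assumes P: "standing_assumptions P"
    and sol: "fluid_solution P x" "fluid_solution P y" and init: "x 0 = y 0"
    and reg: "\<And>t. t \<ge> 0 \<Longrightarrow> x t \<in> regular_states P"
    and T: "T \<ge> 0"
  shows "x T = y T"
proof -
  note cont = solution_continuous[OF sol(1), of 0 T] solution_continuous[OF sol(2), of 0 T]
  have "\<forall>t\<in>{0..T}. x t = y t"
  proof (rule ccontr)
    assume neq: "\<not> ?thesis"
    define A where "A = {t \<in> {0..T}. x t \<noteq> y t}"
    have ne: "A \<noteq> {}" using neq by (auto simp: A_def)
    have bdd: "bdd_below A" by (auto simp: A_def)
    define s where "s = Inf A"
    have s: "0 \<le> s" "s \<le> T"
    proof -
      show "0 \<le> s" unfolding s_def by (rule cInf_greatest[OF ne]) (auto simp: A_def)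
      obtain a where "a \<in> A" using ne by blast
      then have "s \<le> a" unfolding s_def by (rule cInf_lower[OF _ bdd])
      moreover have "a \<le> T" using \<open>a \<in> A\<close> by (simp add: A_def)
      ultimately show "s \<le> T" by simp
    qed
    have before: "x t = y t" if "0 \<le> t" "t < s" for t
      using that cInf_lower[OF _ bdd, of t] s by (force simp: s_def A_def)
    have eq: "x s = y s"
    proof (cases "s = 0")
      case False
      have "closed {t \<in> {0..T}. x t = y t}"
        using continuous_closed_preimage_constant[of "{0..T}" "\<lambda>t. x t - y t" 0] cont
        by (auto intro!: continuous_intros)
      moreover have "s \<in> closure {t \<in> {0..T}. x t = y t}"
      proof (rule subsetD[OF closure_mono])
        show "{0<..<s} \<subseteq> {t \<in> {0..T}. x t = y t}" using before s by auto
        show "s \<in> closure {0<..<s}" using False s by simp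
      qed
      ultimately show ?thesis by (simp add: closure_closed)
    qed (use init in simp)
    obtain d where d: "d > 0" "\<And>t. t \<in> {s..s + d} \<Longrightarrow> x t = y t"
      using regular_agree[OF P sol s(1) eq reg[OF s(1)]] by metis
    have "s + d \<le> Inf A"
    proof (rule cInf_greatest[OF ne])
      fix a assume "a \<in> A"
      then show "s + d \<le> a"
        using before[of a] d(2)[of a] by (force simp: A_def not_le)
    qed
    then show False using d(1) s_def by simp
  qed
  then show ?thesis using T by simp
qed

lemma eventually_at_transfer:
  fixes t :: real
  assumes "t > 0" "\<And>s. s \<ge> 0 \<Longrightarrow> x s = y s"
  shows "(\<forall>\<^sub>F s in at_left t. Q (x s)) \<longleftrightarrow> (\<forall>\<^sub>F s in at_left t. Q (y s))"
    "(\<forall>\<^sub>F s in at_right t. Q (x s)) \<longleftrightarrow> (\<forall>\<^sub>F s in at_right t. Q (y s))"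
proof -
  have "\<forall>\<^sub>F s in at_left t. 0 < s" using assms(1) by (rule eventually_at_leftI[rotated]) auto
  then have "\<forall>\<^sub>F s in at_left t. Q (x s) \<longleftrightarrow> Q (y s)"
    by eventually_elim (use assms(2) in auto)
  then show "(\<forall>\<^sub>F s in at_left t. Q (x s)) \<longleftrightarrow> (\<forall>\<^sub>F s in at_left t. Q (y s))"
    by (rule eventually_subst)
  have "\<forall>\<^sub>F s in at_right t. t < s" by (rule eventually_at_right_less)
  then have "\<forall>\<^sub>F s in at_right t. Q (x s) \<longleftrightarrow> Q (y s)"
    by eventually_elim (use assms in auto)
  then show "(\<forall>\<^sub>F s in at_right t. Q (x s)) \<longleftrightarrow> (\<forall>\<^sub>F s in at_right t. Q (y s))"
    by (rule eventually_subst)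
qed

text \<open>
  Two solutions can be shown to agree at nonnegative times only; switching and crossing are local
  properties at positive times.
\<close>

lemma oscillates_transfer:
  assumes eq: "\<And>s. s \<ge> 0 \<Longrightarrow> x s = y s" and osc: "oscillates_indefinitely P x"
  shows "oscillates_indefinitely P y"
proof -
  have "switch_time P x t \<longleftrightarrow> switch_time P y t" if "t > 0" for t
  proof -
    have "(\<forall>\<^sub>F s in at_left t. x s \<in> A) \<longleftrightarrow> (\<forall>\<^sub>F s in at_left t. y s \<in> A)"
      "(\<forall>\<^sub>F s in at_right t. x s \<in> A) \<longleftrightarrow> (\<forall>\<^sub>F s in at_right t. y s \<in> A)" for A
      using eventually_at_transfer[OF that, of x y, OF eq, of "\<lambda>z. z \<in> A"] by auto
    then show ?thesis by (simp add: switch_time_def)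
  qed
  moreover have "crossing_time P i j x t \<longleftrightarrow> crossing_time P i j y t" if "t > 0" for t i j
    using eventually_at_transfer[OF that, of x y, OF eq, of "\<lambda>z. dif P i j z < 0"]
      eventually_at_transfer[OF that, of x y, OF eq, of "\<lambda>z. dif P i j z > 0"] eq[of t] that
    unfolding crossing_time_def by simp
  ultimately show ?thesis
    using osc unfolding oscillates_indefinitely_def by (meson le_less_trans)
qed

section \<open>The two phases of a half cycle\<close>

lemma exp_decay_deriv: "((\<lambda>t. z * exp (- c * t)) has_real_derivative - c * (z * exp (- c * t))) (at (t::real))"
  by (auto intro!: derivative_eq_intros)

text \<open>
  The phase during which class \<open>i\<close> is helped. Here \<open>p\<close> and \<open>r\<close> are the
  queues of \<open>i\<close> and \<open>j\<close>, and \<open>10230000/1024\<close> is \<open>lam / theta\<close>.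
  The difference \<open>p - r\<close> decreases at a rate between 1 and 2.001, so that it reaches
  \<open>kappa\<close> after a time between 2 and 10, which is long enough for \<open>y\<close> to relax
  towards 1. The quantity \<open>p + r + 9 * (y + w)\<close>, with \<open>9 = (1 - mu) / mu\<close>,
  stays above the line of slope 8/10 that starts at 30.
\<close>

lemma sharing_phase:
  fixes p0 r0 y0 :: real
  assumes y0: "0 \<le> y0" "y0 \<le> 1" and D0: "5 \<le> p0 - r0" "p0 - r0 \<le> 10"
    and E0: "30 \<le> p0 + r0 + 9 * (y0 + 1/1024)"
    and M: "p0 \<le> 10230000/1024" "r0 \<le> 10230000/1024"
  obtains a p r y w where "2 \<le> a"
    "p 0 = p0" "r 0 = r0" "y 0 = y0" "w 0 = 1/1024"
    "\<And>t. (p has_real_derivative 1023/1024 - p t / 10000 - 2 + 9/10 * (y t + w t)) (at t)"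
    "\<And>t. (r has_real_derivative 1023/1024 - r t / 10000) (at t)"
    "\<And>t. (y has_real_derivative 1 - y t) (at t)"
    "\<And>t. (w has_real_derivative - (w t / 10)) (at t)"
    "\<And>t. t \<in> {0..a} \<Longrightarrow> 0 < p t \<and> p t \<le> 10230000/1024 \<and> 0 < r t \<and> r t \<le> 10230000/1024 \<and>
       0 \<le> y t \<and> y t \<le> 1 \<and> 0 < w t \<and> w t \<le> 1/1024"
    "\<And>t. t \<in> {0..<a} \<Longrightarrow> 1/10 < p t - r t"
    "p a - r a = 1/10" "3/4 \<le> y a" "316/10 \<le> p a + r a + 9 * (y a + w a)"
proof -
  define y where "y t = 1 - (1 - y0) * exp (- 1 * t)" for t :: real
  define w where "w t = 1/1024 * exp (- (1/10) * t)" for t :: real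
  have y: "(y has_real_derivative 1 - y t) (at t)" for t
    unfolding y_def using exp_decay_deriv[of "1 - y0" 1 t] by (auto intro!: derivative_eq_intros)
  have w: "(w has_real_derivative - (w t / 10)) (at t)" for t
    unfolding w_def using exp_decay_deriv[of "1/1024" "1/10" t] by simp
  have "continuous_on UNIV (\<lambda>t. 1023/1024 - 2 + 9/10 * (y t + w t))"
    unfolding y_def w_def by (intro continuous_intros)
  from linear_ode_exists[OF this, of p0 "1/10000"] obtain p where p0: "p 0 = p0"
    and p: "\<And>t. (p has_real_derivative 1023/1024 - 2 + 9/10 * (y t + w t) - 1/10000 * p t) (at t)"
    by blast
  from linear_ode_exists[OF continuous_on_const, of r0 "1023/1024" "1/10000"] obtain r where r0: "r 0 = r0"
    and r: "\<And>t. (r has_real_derivative 1023/1024 - 1/10000 * r t) (at t)"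
    by blast
  have y_bounds: "0 \<le> y t" "y t \<le> 1" if "0 \<le> t" for t
    using y0 mult_le_one[of "1 - y0" "exp (- t)"] that by (auto simp: y_def)
  have w_bounds: "0 < w t" "w t \<le> 1/1024" if "0 \<le> t" for t
    using that by (auto simp: w_def)
  define D where "D t = p t - r t" for t
  have D: "(D has_real_derivative 9/10 * (y t + w t) - 2 - 1/10000 * D t) (at t)" for t
    unfolding D_def by (rule derivative_eq_intros p r refl)+ (simp add: field_simps)
  \<comment> \<open>Queue \<open>i\<close> gets all released capacity, \<open>2 - 9/10 * (y + w)\<close>, which is more than 1.\<close>
  have D_le: "D t \<le> 10 - t" if t: "t \<in> {0..10}" for t
  proof -
    have "0 \<le> 10 - t - D t"
    proof (rule nonneg_of_growth_bound[where f = "\<lambda>t. 10 - t - D t" and b = 10 and c = "1/10000" and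
            f' = "\<lambda>t. - 1 - (9/10 * (y t + w t) - 2 - 1/10000 * D t)"])
      fix t :: real assume "t \<in> {0..10}"
      then show "- (1/10000) * (10 - t - D t) \<le> - 1 - (9/10 * (y t + w t) - 2 - 1/10000 * D t)"
        using y_bounds[of t] w_bounds[of t] by (simp add: add_divide_distrib diff_divide_distrib)
    next
      fix t show "((\<lambda>t. 10 - t - D t) has_real_derivative - 1 - (9/10 * (y t + w t) - 2 - 1/10000 * D t)) (at t)"
        by (rule derivative_eq_intros D refl)+ simp
    qed (use t D0 p0 r0 in \<open>auto simp: D_def\<close>)
    then show ?thesis by simp
  qed
  have "continuous_on {0..10} D" by (rule continuous_at_imp_continuous_on) (blast intro: DERIV_isCont D)
  moreover have "1/10 < D 0" "D 10 \<le> 1/10" using D0 D_le[of 10] p0 r0 by (auto simp: D_def)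
  ultimately obtain a where a: "a \<in> {0<..10}" "D a = 1/10" "\<And>t. t \<in> {0..<a} \<Longrightarrow> 1/10 < D t"
    by (rule first_hitting_time) auto
  have D_bounds: "1/10 \<le> D t" "D t \<le> 10" if "t \<in> {0..a}" for t
    using that a D_le[of t] by (cases "t = a"; force)+
  \<comment> \<open>The pools release at most 2 together, and abandonment adds at most \<open>theta * 10\<close>.\<close>
  have "- D a \<le> - D 0 + 2001/1000 * a"
  proof (rule le_of_derivative_le[where f = "\<lambda>t. - D t" and
        f' = "\<lambda>t. - (9/10 * (y t + w t) - 2 - 1/10000 * D t)"])
    fix t assume "t \<in> {0..a}"
    then show "- (9/10 * (y t + w t) - 2 - 1/10000 * D t) \<le> 2001/1000"
      using D_bounds[of t] y_bounds[of t] w_bounds[of t] by (simp add: add_divide_distrib)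
  qed (use a in \<open>auto intro!: derivative_eq_intros D\<close>)
  then have a2: "2 \<le> a" using a(2) D0 p0 r0 by (simp add: D_def)
  have "exp (- 2) \<le> (1/4::real)"
  proof -
    have "(2::real) * 2 \<le> exp 1 * exp 1"
      using exp_ge_add_one_self[of "1::real"] by (intro mult_mono) auto
    then show ?thesis by (simp add: exp_minus field_simps flip: exp_add)
  qed
  moreover have "exp (- a) \<le> exp (- 2)" using a2 by simp
  moreover have "(1 - y0) * exp (- a) \<le> 1 * exp (- a)" using y0 by (intro mult_right_mono) auto
  ultimately have "(1 - y0) * exp (- a) \<le> 1/4" by linarith
  then have ya: "3/4 \<le> y a" by (simp add: y_def)
  define E where "E t = p t + r t + 9 * (y t + w t)" for t
  \<comment> \<open>The terms \<open>9/10 * w\<close> cancel, and as \<open>y \<le> 1\<close> the growth rate is, apart from abandonment, at least \<open>9/10 - 2 * tau\<close>.\<close>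
  have E: "(E has_real_derivative 9/10 - 2/1024 + 81/10 * (1 - y t) - 1/10000 * (p t + r t)) (at t)" for t
    unfolding E_def by (rule derivative_eq_intros p r y w refl)+ (simp add: field_simps)
  have E_ge: "30 + 8/10 * t \<le> E t" if t: "t \<in> {0..a}" for t
  proof -
    have "0 \<le> E t - 30 - 8/10 * t"
    proof (rule nonneg_of_growth_bound[where f = "\<lambda>t. E t - 30 - 8/10 * t" and b = a and c = "1/10000"
          and f' = "\<lambda>t. 9/10 - 2/1024 + 81/10 * (1 - y t) - 1/10000 * (p t + r t) - 8/10"])
      show "0 \<le> E 0 - 30 - 8/10 * 0"
        using E0 p0 r0 by (simp add: E_def y_def w_def)
    next
      fix t assume t: "t \<in> {0..a}"
      then show "- (1/10000) * (E t - 30 - 8/10 * t)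
          \<le> 9/10 - 2/1024 + 81/10 * (1 - y t) - 1/10000 * (p t + r t) - 8/10"
        using y_bounds[of t] w_bounds[of t] a(1)
        by (simp add: E_def add_divide_distrib diff_divide_distrib)
    qed (use t in \<open>auto intro!: derivative_eq_intros E\<close>)
    then show ?thesis by simp
  qed
  have p_le: "p t \<le> 10230000/1024" if t: "t \<in> {0..a}" for t
  proof -
    have "0 \<le> 10230000/1024 - p t"
    proof (rule nonneg_of_growth_bound[where f = "\<lambda>t. 10230000/1024 - p t" and b = a and c = "1/10000"
            and f' = "\<lambda>t. - (1023/1024 - 2 + 9/10 * (y t + w t) - 1/10000 * p t)"])
      fix t assume "t \<in> {0..a}"
      then show "- (1/10000) * (10230000/1024 - p t) \<le> - (1023/1024 - 2 + 9/10 * (y t + w t) - 1/10000 * p t)"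
        using y_bounds[of t] w_bounds[of t] by (simp add: add_divide_distrib diff_divide_distrib)
    qed (use t M p0 in \<open>auto intro!: derivative_eq_intros p\<close>)
    then show ?thesis by simp
  qed
  have r_le: "r t \<le> 10230000/1024" if t: "t \<in> {0..a}" for t
  proof -
    have "0 \<le> 10230000/1024 - r t"
    proof (rule nonneg_of_growth_bound[where f = "\<lambda>t. 10230000/1024 - r t" and b = a and c = "1/10000"
            and f' = "\<lambda>t. - (1023/1024 - 1/10000 * r t)"])
      fix t assume "t \<in> {0..a}"
      then show "- (1/10000) * (10230000/1024 - r t) \<le> - (1023/1024 - 1/10000 * r t)"
        using y_bounds[of t] w_bounds[of t] by (simp add: add_divide_distrib diff_divide_distrib)
    qed (use t M r0 in \<open>auto intro!: derivative_eq_intros r\<close>)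
    then show ?thesis by simp
  qed
  show thesis
  proof (rule that[of a p r y w])
    show "y 0 = y0" "w 0 = 1/1024" by (simp_all add: y_def w_def)
    show "(p has_real_derivative 1023/1024 - p t / 10000 - 2 + 9/10 * (y t + w t)) (at t)" for t
      using p[of t] by (simp add: algebra_simps)
    show "(r has_real_derivative 1023/1024 - r t / 10000) (at t)" for t
      using r[of t] by simp
    fix t assume t: "t \<in> {0..a}"
    have "0 < p t" "0 < r t"
      using E_ge[OF t] D_bounds[OF t] y_bounds[of t] w_bounds[of t] t by (auto simp: E_def D_def)
    then show "0 < p t \<and> p t \<le> 10230000/1024 \<and> 0 < r t \<and> r t \<le> 10230000/1024 \<and>
       0 \<le> y t \<and> y t \<le> 1 \<and> 0 < w t \<and> w t \<le> 1/1024"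
      using p_le[OF t] r_le[OF t] y_bounds[of t] w_bounds[of t] t by auto
  next
    show "316/10 \<le> p a + r a + 9 * (y a + w a)"
      using E_ge[of a] a2 by (simp add: E_def)
  qed (use a2 p0 r0 y w a ya in \<open>auto simp: D_def\<close>)
qed

text \<open>
  The phase without sharing, which lasts until \<open>y\<close> has decayed to \<open>tau\<close>. With
  \<open>D = p - r\<close> and \<open>W = y - w\<close>, the quantity \<open>9 * W - D\<close> changes only at
  the rate \<open>theta * D\<close>, so the drop of \<open>D\<close> is, up to a small error, 9 times the drop
  of \<open>W\<close>, which is at least almost \<open>3/4\<close>. The time \<open>d\<close> is one at which
  \<open>D\<close> crosses \<open>- kappa\<close>; there \<open>W\<close> is large enough compared with
  \<open>theta * kappa\<close> to make the derivative negative.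
\<close>

lemma own_phase:
  fixes p0 r0 y0 w0 :: real
  assumes y0: "3/4 \<le> y0" "y0 \<le> 1" and w0: "0 \<le> w0" "w0 \<le> 1/1024" and D0: "p0 - r0 = 1/10"
    and E0: "316/10 \<le> p0 + r0 + 9 * (y0 + w0)"
    and M: "p0 \<le> 10230000/1024" "r0 \<le> 10230000/1024"
  obtains b p r y w d l where "1 \<le> b"
    "p 0 = p0" "r 0 = r0" "y 0 = y0" "w 0 = w0"
    "\<And>t. (p has_real_derivative 1023/1024 - p t / 10000 - 1 + 9/10 * w t) (at t)"
    "\<And>t. (r has_real_derivative 1023/1024 - r t / 10000 - 1 + 9/10 * y t) (at t)"
    "\<And>t. (y has_real_derivative - (y t / 10)) (at t)"
    "\<And>t. (w has_real_derivative - (w t / 10)) (at t)"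
    "\<And>t. t \<in> {0..b} \<Longrightarrow> 0 < p t \<and> p t \<le> 10230000/1024 \<and> 0 < r t \<and> r t \<le> 10230000/1024 \<and>
       0 \<le> y t \<and> y t \<le> 1 \<and> 0 \<le> w t \<and> w t \<le> 1"
    "\<And>t. t \<in> {0<..<b} \<Longrightarrow> p t - r t < 1/10 \<and> 1/1024 < y t"
    "d \<in> {0<..<b}" "p d - r d = - 1/10" "((\<lambda>t. p t - r t) has_real_derivative l) (at d)" "l < 0"
    "y b = 1/1024" "5 \<le> r b - p b" "r b - p b \<le> 10" "30 \<le> p b + r b + 9 * (y b + w b)"
proof -
  define b where "b = 10 * ln (1024 * y0)"
  have eb: "exp (- (1/10) * b) = 1 / (1024 * y0)"
    using y0 by (simp add: b_def exp_minus field_simps)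
  have b: "1 \<le> b" "b \<le> 100"
  proof -
    have "exp (1/10) \<le> exp (1::real)" by simp
    also have "\<dots> \<le> 3" by (rule exp_le)
    also have "\<dots> \<le> 1024 * y0" using y0 by simp
    finally have "1/10 \<le> ln (1024 * y0)" using y0 by (subst ln_ge_iff) auto
    then show "1 \<le> b" by (simp add: b_def)
    \<comment> \<open>A power of 2 as \<open>tau\<close> makes \<open>exp 1 \<ge> 2\<close> a sufficient estimate.\<close>
    have "(2::real) ^ 10 \<le> exp 1 ^ 10"
      using exp_ge_add_one_self[of "1::real"] by (intro power_mono) auto
    then have "1024 * y0 \<le> exp 10" using y0 by (simp flip: exp_of_nat_mult)
    then have "ln (1024 * y0) \<le> 10" using ln_le_cancel_iff[of "1024 * y0" "exp 10"] y0 by simp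
    then show "b \<le> 100" by (simp add: b_def)
  qed
  define y where "y t = y0 * exp (- (1/10) * t)" for t :: real
  define w where "w t = w0 * exp (- (1/10) * t)" for t :: real
  have y: "(y has_real_derivative - (y t / 10)) (at t)" for t
    unfolding y_def using exp_decay_deriv[of y0 "1/10" t] by simp
  have w: "(w has_real_derivative - (w t / 10)) (at t)" for t
    unfolding w_def using exp_decay_deriv[of w0 "1/10" t] by simp
  have yb: "y b = 1/1024" using eb y0 by (simp add: y_def)
  have y_gt: "1/1024 < y t" if "t < b" for t
  proof -
    have "y b < y t" unfolding y_def using that y0 by simp
    then show ?thesis using yb by simp
  qed
  have y_bounds: "0 \<le> y t" "y t \<le> 1" if "0 \<le> t" for t
    using y0 mult_le_one[of y0 "exp (- (1/10) * t)"] that by (auto simp: y_def)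
  have w_bounds: "0 \<le> w t" "w t \<le> 1/1024" if "0 \<le> t" for t
    using w0 mult_mono[of w0 "1/1024" "exp (- (1/10) * t)" 1] that by (auto simp: w_def)
  have "continuous_on UNIV (\<lambda>t. 1023/1024 - 1 + 9/10 * w t)"
    unfolding w_def by (intro continuous_intros)
  from linear_ode_exists[OF this, of p0 "1/10000"] obtain p where p0: "p 0 = p0"
    and p: "\<And>t. (p has_real_derivative 1023/1024 - 1 + 9/10 * w t - 1/10000 * p t) (at t)"
    by blast
  have "continuous_on UNIV (\<lambda>t. 1023/1024 - 1 + 9/10 * y t)"
    unfolding y_def by (intro continuous_intros)
  from linear_ode_exists[OF this, of r0 "1/10000"] obtain r where r0: "r 0 = r0"
    and r: "\<And>t. (r has_real_derivative 1023/1024 - 1 + 9/10 * y t - 1/10000 * r t) (at t)"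
    by blast
  define D where "D t = p t - r t" for t
  define W where "W t = y t - w t" for t
  have W_eq: "W t = (y0 - w0) * exp (- (1/10) * t)" for t
    by (simp add: W_def y_def w_def algebra_simps)
  have W_pos: "0 < W t" for t using y0 w0 by (simp add: W_eq)
  \<comment> \<open>At the end \<open>W\<close> is \<open>(y0 - w0) / (1024 * y0)\<close>, and \<open>W\<close> is decreasing.\<close>
  have W_ge: "7/10240 \<le> W t" if "t \<in> {0..b}" for t
  proof -
    have "7/10240 \<le> (y0 - w0) * (1 / (1024 * y0))"
      using y0 w0 by (simp add: field_simps)
    also have "\<dots> = W b" using eb W_eq by simp
    also have "\<dots> \<le> W t" using that y0 w0 by (simp add: W_eq)
    finally show ?thesis .
  qed
  have D: "(D has_real_derivative - (9/10) * W t - 1/10000 * D t) (at t)" for t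
    unfolding D_def W_def by (rule derivative_eq_intros p r refl)+ (simp add: field_simps)
  have D_less: "D t < 1/10" if t: "t \<in> {0<..b}" for t
  proof -
    have "0 < 1/10 - D t"
    proof (rule pos_of_growth_bound[where f = "\<lambda>t. 1/10 - D t" and b = b and c = "1/10000" and
            f' = "\<lambda>t. 9/10 * W t + 1/10000 * D t"])
      fix r show "((\<lambda>t. 1/10 - D t) has_real_derivative 9/10 * W r + 1/10000 * D r) (at r)"
        by (auto intro!: derivative_eq_intros D)
      show "- (1/10000) * (1/10 - D r) < 9/10 * W r + 1/10000 * D r"
        using W_pos[of r] by (simp add: diff_divide_distrib)
    qed (use t D0 p0 r0 in \<open>auto simp: D_def\<close>)
    then show ?thesis by simp
  qed
  have D_le: "D t \<le> 1/10" if "t \<in> {0..b}" for t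
    using D_less[of t] that D0 p0 r0 by (cases "t = 0") (auto simp: D_def)
  define H where "H t = 9 * W t - D t" for t
  have H: "(H has_real_derivative 1/10000 * D t) (at t)" for t
    unfolding H_def W_def by (rule derivative_eq_intros D[unfolded W_def] y w refl)+ (simp add: field_simps)
  have H0: "H 0 = 9 * (y0 - w0) - 1/10" using D0 p0 r0 by (simp add: H_def D_def W_def y_def w_def)
  have D_ge: "- 10 \<le> D t" if t: "t \<in> {0..b}" for t
  proof -
    have "H t \<le> H 0 + 1/100000 * t"
      by (rule le_of_derivative_le[OF H _ t]) (use D_le in force)
    then show ?thesis using H0 W_pos[of t] y0 w0 t b by (simp add: H_def)
  qed
  have Db: "D b \<le> - 5"
  proof -
    have "- H b \<le> - H 0 + 1/1000 * b"
      by (rule le_of_derivative_le[where f = "\<lambda>t. - H t" and f' = "\<lambda>t. - (1/10000 * D t)" and b = b])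
        (use D_ge b in \<open>force intro!: derivative_eq_intros H\<close>)+
    moreover have "W b \<le> 1/1024" using yb w_bounds[of b] b by (simp add: W_def)
    ultimately show ?thesis using H0 y0 w0 b by (simp add: H_def)
  qed
  define E where "E t = p t + r t + 9 * (y t + w t)" for t
  have E: "(E has_real_derivative - 2/1024 - 1/10000 * (p t + r t)) (at t)" for t
    unfolding E_def by (rule derivative_eq_intros p r y w refl)+ (simp add: field_simps)
  \<comment> \<open>At this level the loss rate is at most \<open>2 * tau + theta * 316/10 < 1/100\<close>; over a time of at most 100 this costs at most 1, less than the 16/10 gained while sharing.\<close>
  have E_ge: "316/10 - t / 100 \<le> E t" if t: "t \<in> {0..b}" for t
  proof -
    have "0 \<le> E t - 316/10 + t / 100"
    proof (rule nonneg_of_growth_bound[where f = "\<lambda>t. E t - 316/10 + t / 100" and b = b and c = "1/10000"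
          and f' = "\<lambda>t. - 2/1024 - 1/10000 * (p t + r t) + 1/100"])
      show "0 \<le> E 0 - 316/10 + 0 / 100"
        using E0 p0 r0 by (simp add: E_def y_def w_def)
    next
      fix t assume t: "t \<in> {0..b}"
      then show "- (1/10000) * (E t - 316/10 + t / 100) \<le> - 2/1024 - 1/10000 * (p t + r t) + 1/100"
        using y_bounds[of t] w_bounds[of t] b
        by (simp add: E_def add_divide_distrib diff_divide_distrib)
    qed (use t in \<open>auto intro!: derivative_eq_intros E\<close>)
    then show ?thesis by simp
  qed
  have p_le: "p t \<le> 10230000/1024" if t: "t \<in> {0..b}" for t
  proof -
    have "0 \<le> 10230000/1024 - p t"
    proof (rule nonneg_of_growth_bound[where f = "\<lambda>t. 10230000/1024 - p t" and b = b and c = "1/10000"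
            and f' = "\<lambda>t. - (1023/1024 - 1 + 9/10 * w t - 1/10000 * p t)"])
      fix t assume "t \<in> {0..b}"
      then show "- (1/10000) * (10230000/1024 - p t) \<le> - (1023/1024 - 1 + 9/10 * w t - 1/10000 * p t)"
        using y_bounds[of t] w_bounds[of t] by (simp add: add_divide_distrib diff_divide_distrib)
    qed (use t M p0 in \<open>auto intro!: derivative_eq_intros p\<close>)
    then show ?thesis by simp
  qed
  have r_le: "r t \<le> 10230000/1024" if t: "t \<in> {0..b}" for t
  proof -
    have "0 \<le> 10230000/1024 - r t"
    proof (rule nonneg_of_growth_bound[where f = "\<lambda>t. 10230000/1024 - r t" and b = b and c = "1/10000"
            and f' = "\<lambda>t. - (1023/1024 - 1 + 9/10 * y t - 1/10000 * r t)"])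
      fix t assume "t \<in> {0..b}"
      then show "- (1/10000) * (10230000/1024 - r t) \<le> - (1023/1024 - 1 + 9/10 * y t - 1/10000 * r t)"
        using y_bounds[of t] w_bounds[of t] by (simp add: add_divide_distrib diff_divide_distrib)
    qed (use t M r0 in \<open>auto intro!: derivative_eq_intros r\<close>)
    then show ?thesis by simp
  qed
  have "continuous_on {0..b} D" by (rule continuous_at_imp_continuous_on) (blast intro: DERIV_isCont D)
  then obtain d where d: "0 \<le> d" "d \<le> b" "D d = - 1/10"
    using IVT2'[of D b "- 1/10" 0] Db D0 p0 r0 b by (auto simp: D_def)
  then have d': "d \<in> {0<..<b}"
    using Db D0 p0 r0 by (cases "d = 0"; cases "d = b") (auto simp: D_def)
  show thesis
  proof (rule that[of b p r y w d "- (9/10) * W d - 1/10000 * D d"])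
    show "y 0 = y0" "w 0 = w0" by (simp_all add: y_def w_def)
    show "(p has_real_derivative 1023/1024 - p t / 10000 - 1 + 9/10 * w t) (at t)" for t
      using p[of t] by (simp add: algebra_simps)
    show "(r has_real_derivative 1023/1024 - r t / 10000 - 1 + 9/10 * y t) (at t)" for t
      using r[of t] by (simp add: algebra_simps)
    show "- (9/10) * W d - 1/10000 * D d < 0"
      using W_ge[of d] d by simp
    show "((\<lambda>t. p t - r t) has_real_derivative - (9/10) * W d - 1/10000 * D d) (at d)"
      using D[of d] by (simp add: D_def[abs_def])
  next
    fix t assume t: "t \<in> {0..b}"
    \<comment> \<open>The sum of the queues exceeds 20 and their difference is at most 10 in absolute value.\<close>
    have "0 < p t" "0 < r t"
      using E_ge[OF t] D_ge[OF t] D_le[OF t] y_bounds[of t] w_bounds[of t] t b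
      by (auto simp: E_def D_def)
    then show "0 < p t \<and> p t \<le> 10230000/1024 \<and> 0 < r t \<and> r t \<le> 10230000/1024 \<and>
       0 \<le> y t \<and> y t \<le> 1 \<and> 0 \<le> w t \<and> w t \<le> 1"
      using p_le[OF t] r_le[OF t] y_bounds[of t] w_bounds[of t] t by auto
  next
    show "30 \<le> p b + r b + 9 * (y b + w b)"
      using E_ge[of b] b by (simp add: E_def)
    show "5 \<le> r b - p b" "r b - p b \<le> 10" using Db D_ge[of b] b by (auto simp: D_def)
  next
    fix t assume "t \<in> {0<..<b}"
    then show "p t - r t < 1/10 \<and> 1/1024 < y t" using D_less[of t] y_gt[of t] by (auto simp: D_def)
  qed (use b p0 r0 y w d d' yb in \<open>auto simp: D_def\<close>)
qed

section \<open>States with full pools in the chosen model\<close>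

definition model :: params where
  "model = \<lparr>lam = 1023/1024, mu = 1/10, theta = 1/10000, kappa = 1/10, tau = 1/1024\<rparr>"

lemma model_simps [simp]:
  "lam model = 1023/1024" "mu model = 1/10" "theta model = 1/10000" "kappa model = 1/10"
  "tau model = 1/1024"
  by (simp_all add: model_def)

lemma model_standing: "standing_assumptions model"
  by (simp add: standing_assumptions_def)

text \<open>
  When both pools are full, a state is determined by the two queues and the amounts of fluid
  in the wrong pool. All computations are done in these four coordinates, for either order of the
  classes.
\<close>

definition full_state :: "2 \<Rightarrow> 2 \<Rightarrow> real \<Rightarrow> real \<Rightarrow> real \<Rightarrow> real \<Rightarrow> state" where
  "full_state i j p r y w =
     ((\<chi> k. if k = i then p else r),
      (\<chi> k l. if k = i then (if l = i then 1 - w else y) else (if l = i then w else 1 - y)))"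

lemma full_state_simps:
  assumes "i \<noteq> j"
  shows "queue (full_state i j p r y w) i = p" "queue (full_state i j p r y w) j = r"
    "serv (full_state i j p r y w) i j = y" "serv (full_state i j p r y w) j i = w"
    "serv (full_state i j p r y w) i i = 1 - w" "serv (full_state i j p r y w) j j = 1 - y"
  using assms by (auto simp: full_state_def)

lemma both_full_full_state: "i \<noteq> j \<Longrightarrow> both_full (full_state i j p r y w)"
  by (simp add: both_full_def full_pair all_pair full_state_simps)

lemma full_state_eqI:
  assumes "i \<noteq> j" "both_full x"
  shows "x = full_state i j (queue x i) (queue x j) (serv x i j) (serv x j i)"
  using assms by (auto simp: prod_eq_iff vec_eq_iff all_pair[OF assms(1)] both_full_def
      full_pair[OF assms(1)] full_state_simps)

lemma full_state_in_state_space: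
  assumes "i \<noteq> j"
  shows "full_state i j p r y w \<in> state_space P \<longleftrightarrow>
    0 \<le> p \<and> p \<le> lam P / theta P \<and> 0 \<le> r \<and> r \<le> lam P / theta P \<and>
    0 \<le> y \<and> y \<le> 1 \<and> 0 \<le> w \<and> w \<le> 1"
proof -
  have "(\<forall>k. serv x 1 k + serv x 2 k \<le> 1) \<longleftrightarrow> (\<forall>k. serv x i k + serv x j k \<le> 1)" for x :: state
    using assms by (elim pair_cases) (auto simp: add.commute)
  then show ?thesis
    by (auto simp: state_space_def all_pair[OF assms] full_state_simps[OF assms])
qed

lemma positive_queues_full_state:
  "i \<noteq> j \<Longrightarrow> positive_queues (full_state i j p r y w) \<longleftrightarrow> 0 < p \<and> 0 < r"
  by (auto simp: positive_queues_def all_pair full_state_simps)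

lemma dif_full_state:
  assumes "i \<noteq> j"
  shows "dif P i j (full_state i j p r y w) = p - r - kappa P"
    "dif P j i (full_state i j p r y w) = r - p - kappa P"
  by (simp_all add: dif_def full_state_simps assms)

definition full_velocity :: "2 \<Rightarrow> real \<Rightarrow> real \<Rightarrow> real \<Rightarrow> real \<Rightarrow> state" where
  "full_velocity i p' r' y' w' =
     ((\<chi> k. if k = i then p' else r'),
      (\<chi> k l. if k = i then (if l = i then - w' else y') else (if l = i then w' else - y')))"

lemma full_state_has_derivative:
  assumes "(p has_real_derivative p') (at t)" "(r has_real_derivative r') (at t)"
    "(y has_real_derivative y') (at t)" "(w has_real_derivative w') (at t)"
  shows "((\<lambda>t. full_state i j (p t) (r t) (y t) (w t)) has_vector_derivative
      full_velocity i p' r' y' w') (at t)"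
proof -
  have d: "((\<lambda>t. 1 - f t) has_vector_derivative - f') (at t)"
    if "(f has_real_derivative f') (at t)" for f f'
    unfolding has_real_derivative_iff_has_vector_derivative[symmetric]
    using that by (auto intro!: derivative_eq_intros)
  note * = assms[unfolded has_real_derivative_iff_has_vector_derivative]
  show ?thesis
    unfolding full_state_def full_velocity_def
    by (intro has_vector_derivative_Pair has_vector_derivative_vecI)
      (auto intro!: * d assms)
qed

lemma sharing_field_full_state:
  assumes "i \<noteq> j"
  shows "sharing_field P i (full_state i j p r y w) =
    full_velocity i (lam P - theta P * p - 2 + (1 - mu P) * (y + w)) (lam P - theta P * r)
      (1 - y) (- mu P * w)"
proof -
  let ?x = "full_state i j p r y w"
  have rel: "released P ?x j = 1 - (1 - mu P) * y" "released P ?x i = 1 - (1 - mu P) * w"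
    using both_full_full_state[OF assms] released_own[OF assms, of ?x P]
      released_own[OF assms[symmetric], of ?x P]
    by (auto simp: both_full_def full_state_simps[OF assms])
  show ?thesis
    unfolding sharing_field_def prod_eq_iff vec_eq_iff all_pair[OF assms]
      queue_velocity_pair[OF assms] serv_velocity
    using assms
    by (auto simp: sharing_rates_def full_velocity_def full_state_simps rel service_rate_def
        algebra_simps)
qed

lemma own_field_full_state:
  assumes "i \<noteq> j"
  shows "own_field P (full_state i j p r y w) =
    full_velocity i (lam P - theta P * p - 1 + (1 - mu P) * w)
      (lam P - theta P * r - 1 + (1 - mu P) * y) (- mu P * y) (- mu P * w)"
proof -
  let ?x = "full_state i j p r y w"
  have rel: "released P ?x j = 1 - (1 - mu P) * y" "released P ?x i = 1 - (1 - mu P) * w"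
    using both_full_full_state[OF assms] released_own[OF assms, of ?x P]
      released_own[OF assms[symmetric], of ?x P]
    by (auto simp: both_full_def full_state_simps[OF assms])
  show ?thesis
    unfolding own_field_def prod_eq_iff vec_eq_iff all_pair[OF assms]
      queue_velocity_pair[OF assms] serv_velocity
    using assms
    by (auto simp: own_rates_def full_velocity_def full_state_simps rel service_rate_def
        algebra_simps)
qed

section \<open>Pieces of a trajectory\<close>

text \<open>
  At the common end point of two pieces the sharing piece determines to which set the state
  belongs; a piece without sharing makes no claim about its end points.
\<close>

definition sharing_piece :: "params \<Rightarrow> 2 \<Rightarrow> 2 \<Rightarrow> real \<Rightarrow> real \<Rightarrow> (real \<Rightarrow> state) \<Rightarrow> bool" where
  "sharing_piece P i j s t x \<longleftrightarrow>
     s + 1 \<le> t \<and> continuous_on {s..t} x \<and>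
     (\<forall>r\<in>{s..<t}. x r \<in> sharing_states P i j) \<and> x t \<in> exit_states P i j \<and>
     (\<forall>r\<in>{s<..<t}. (x has_vector_derivative sharing_field P i (x r)) (at r))"

definition own_piece :: "params \<Rightarrow> 2 \<Rightarrow> 2 \<Rightarrow> real \<Rightarrow> real \<Rightarrow> (real \<Rightarrow> state) \<Rightarrow> bool" where
  "own_piece P i j s t x \<longleftrightarrow>
     s + 1 \<le> t \<and> continuous_on {s..t} x \<and>
     (\<forall>r\<in>{s<..<t}. x r \<in> own_states P i j) \<and>
     (\<forall>r\<in>{s<..<t}. (x has_vector_derivative own_field P (x r)) (at r)) \<and>
     (\<exists>d\<in>{s<..<t}. crossing_time P j i x d)"

text \<open>
  The box of states from which sharing starts. The lower bound 5 for the difference of the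
  queues makes the sharing phase long enough, and the bound 30 keeps the queues positive.
\<close>

definition sharing_start :: "2 \<Rightarrow> 2 \<Rightarrow> state set" where
  "sharing_start i j = {x. both_full x \<and>
     0 \<le> serv x i j \<and> serv x i j \<le> 1 \<and> serv x j i = 1/1024 \<and>
     5 \<le> queue x i - queue x j \<and> queue x i - queue x j \<le> 10 \<and>
     30 \<le> queue x i + queue x j + 9 * (serv x i j + serv x j i) \<and>
     (\<forall>k. queue x k \<le> lam model / theta model)}"

definition own_start :: "2 \<Rightarrow> 2 \<Rightarrow> state set" where
  "own_start i j = {x. both_full x \<and>
     3/4 \<le> serv x i j \<and> serv x i j \<le> 1 \<and> 0 \<le> serv x j i \<and> serv x j i \<le> 1/1024 \<and>
     queue x i - queue x j = 1/10 \<and>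
     316/10 \<le> queue x i + queue x j + 9 * (serv x i j + serv x j i) \<and>
     (\<forall>k. queue x k \<le> lam model / theta model)}"

lemma sharing_piece_exists:
  assumes ij: "i \<noteq> j" and x0: "x0 \<in> sharing_start i j"
  obtains t x where "sharing_piece model i j s t x" "x s = x0" "x t \<in> own_start i j"
proof -
  have "0 \<le> serv x0 i j" "serv x0 i j \<le> 1" "5 \<le> queue x0 i - queue x0 j"
    "queue x0 i - queue x0 j \<le> 10" "30 \<le> queue x0 i + queue x0 j + 9 * (serv x0 i j + 1/1024)"
    "queue x0 i \<le> 10230000/1024" "queue x0 j \<le> 10230000/1024"
    using x0 by (auto simp: sharing_start_def all_pair[OF ij])
  from sharing_phase[OF this] obtain a p r y w where a: "2 \<le> a"
    and init: "p 0 = queue x0 i" "r 0 = queue x0 j" "y 0 = serv x0 i j" "w 0 = 1/1024"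
    and d: "\<And>t. (p has_real_derivative 1023/1024 - p t / 10000 - 2 + 9/10 * (y t + w t)) (at t)"
    "\<And>t. (r has_real_derivative 1023/1024 - r t / 10000) (at t)"
    "\<And>t. (y has_real_derivative 1 - y t) (at t)"
    "\<And>t. (w has_real_derivative - (w t / 10)) (at t)"
    and bounds: "\<And>t. t \<in> {0..a} \<Longrightarrow> 0 < p t \<and> p t \<le> 10230000/1024 \<and> 0 < r t \<and> r t \<le> 10230000/1024 \<and>
       0 \<le> y t \<and> y t \<le> 1 \<and> 0 < w t \<and> w t \<le> 1/1024"
    and D: "\<And>t. t \<in> {0..<a} \<Longrightarrow> 1/10 < p t - r t"
    and fin: "p a - r a = 1/10" "3/4 \<le> y a" "316/10 \<le> p a + r a + 9 * (y a + w a)"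
    by blast
  define X where "X t = full_state i j (p (t - s)) (r (t - s)) (y (t - s)) (w (t - s))" for t
  have X: "(X has_vector_derivative sharing_field model i (X t)) (at t)" for t
    unfolding X_def sharing_field_full_state[OF ij]
    by (rule has_vector_derivative_shift[where f = "\<lambda>t. full_state i j (p t) (r t) (y t) (w t)"])
      (use full_state_has_derivative[OF d] in simp)
  have cont: "continuous_on {s..s + a} X"
    using X by (auto intro!: continuous_at_imp_continuous_on has_vector_derivative_continuous)
  have S: "X t \<in> state_space model" "both_full (X t)" "positive_queues (X t)" if "t \<in> {s..s + a}" for t
    using bounds[of "t - s"] that
    by (auto simp: X_def full_state_in_state_space[OF ij] both_full_full_state[OF ij]
        positive_queues_full_state[OF ij])
  have "X t \<in> sharing_states model i j" if "t \<in> {s..<s + a}" for t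
    using S[of t] D[of "t - s"] bounds[of "t - s"] that
    by (auto simp: sharing_states_def active_sharing_def X_def dif_full_state[OF ij]
        full_state_simps[OF ij])
  moreover have "X (s + a) \<in> exit_states model i j"
    using S[of "s + a"] fin bounds[of a] a
    by (auto simp: exit_states_def sliding_manifold_def X_def dif_full_state[OF ij]
        full_state_simps[OF ij])
  ultimately have "sharing_piece model i j s (s + a) X"
    using a cont X by (auto simp: sharing_piece_def)
  moreover have "X s = x0"
  proof -
    have "both_full x0" "serv x0 j i = 1/1024" using x0 by (auto simp: sharing_start_def)
    then show ?thesis using full_state_eqI[OF ij, of x0] by (simp only: X_def init diff_self)
  qed
  moreover have "X (s + a) \<in> own_start i j"
    using fin bounds[of a] a
    by (auto simp: own_start_def X_def both_full_full_state[OF ij] full_state_simps[OF ij]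
        all_pair[OF ij])
  ultimately show thesis using that by blast
qed

text \<open>
  The final state is in the box for sharing with the classes exchanged, which closes the
  cycle.
\<close>

lemma own_piece_exists:
  assumes ij: "i \<noteq> j" and x0: "x0 \<in> own_start i j"
  obtains t x where "own_piece model i j s t x" "x s = x0" "x t \<in> sharing_start j i"
proof -
  have "3/4 \<le> serv x0 i j" "serv x0 i j \<le> 1" "0 \<le> serv x0 j i" "serv x0 j i \<le> 1/1024"
    "queue x0 i - queue x0 j = 1/10"
    "316/10 \<le> queue x0 i + queue x0 j + 9 * (serv x0 i j + serv x0 j i)"
    "queue x0 i \<le> 10230000/1024" "queue x0 j \<le> 10230000/1024"
    using x0 by (auto simp: own_start_def all_pair[OF ij])
  from own_phase[OF this] obtain b p r y w c l where b: "1 \<le> b"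
    and init: "p 0 = queue x0 i" "r 0 = queue x0 j" "y 0 = serv x0 i j" "w 0 = serv x0 j i"
    and d: "\<And>t. (p has_real_derivative 1023/1024 - p t / 10000 - 1 + 9/10 * w t) (at t)"
    "\<And>t. (r has_real_derivative 1023/1024 - r t / 10000 - 1 + 9/10 * y t) (at t)"
    "\<And>t. (y has_real_derivative - (y t / 10)) (at t)"
    "\<And>t. (w has_real_derivative - (w t / 10)) (at t)"
    and bounds: "\<And>t. t \<in> {0..b} \<Longrightarrow> 0 < p t \<and> p t \<le> 10230000/1024 \<and> 0 < r t \<and> r t \<le> 10230000/1024 \<and>
       0 \<le> y t \<and> y t \<le> 1 \<and> 0 \<le> w t \<and> w t \<le> 1"
    and D: "\<And>t. t \<in> {0<..<b} \<Longrightarrow> p t - r t < 1/10 \<and> 1/1024 < y t"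
    and c: "c \<in> {0<..<b}" "p c - r c = - 1/10" "((\<lambda>t. p t - r t) has_real_derivative l) (at c)" "l < 0"
    and fin: "y b = 1/1024" "5 \<le> r b - p b" "r b - p b \<le> 10" "30 \<le> p b + r b + 9 * (y b + w b)"
    by blast
  define X where "X t = full_state i j (p (t - s)) (r (t - s)) (y (t - s)) (w (t - s))" for t
  have X: "(X has_vector_derivative own_field model (X t)) (at t)" for t
    unfolding X_def own_field_full_state[OF ij]
    by (rule has_vector_derivative_shift[where f = "\<lambda>t. full_state i j (p t) (r t) (y t) (w t)"])
      (use full_state_has_derivative[OF d] in simp)
  have cont: "continuous_on {s..s + b} X"
    using X by (auto intro!: continuous_at_imp_continuous_on has_vector_derivative_continuous)
  have S: "X t \<in> state_space model" "both_full (X t)" "positive_queues (X t)" if "t \<in> {s..s + b}" for t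
    using bounds[of "t - s"] that
    by (auto simp: X_def full_state_in_state_space[OF ij] both_full_full_state[OF ij]
        positive_queues_full_state[OF ij])
  have "X t \<in> own_states model i j" if "t \<in> {s<..<s + b}" for t
    using S[of t] D[of "t - s"] that
    by (auto simp: own_states_def X_def dif_full_state[OF ij] full_state_simps[OF ij])
  moreover have "crossing_time model j i X (s + c)"
  proof -
    have D_eq: "dif model j i (X t) = - 1/10 - (p (t - s) - r (t - s))" for t
      by (simp add: X_def dif_full_state[OF ij])
    obtain e where e: "e > 0" "\<And>h. h > 0 \<Longrightarrow> h < e \<Longrightarrow> p c - r c < p (c - h) - r (c - h)"
      using DERIV_neg_dec_left[OF c(3,4)] by blast
    obtain e' where e': "e' > 0" "\<And>h. h > 0 \<Longrightarrow> h < e' \<Longrightarrow> p (c + h) - r (c + h) < p c - r c"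
      using DERIV_neg_dec_right[OF c(3,4)] by blast
    have "\<forall>\<^sub>F t in at_left (s + c). dif model j i (X t) < 0"
    proof (rule eventually_at_leftI)
      fix t assume t: "t \<in> {s + c - e<..<s + c}"
      then show "dif model j i (X t) < 0"
        using e(2)[of "s + c - t"] c(2) by (simp add: D_eq)
    qed (use e in simp)
    moreover have "\<forall>\<^sub>F t in at_right (s + c). dif model j i (X t) > 0"
    proof (rule eventually_at_rightI)
      fix t assume t: "t \<in> {s + c<..<s + c + e'}"
      then show "dif model j i (X t) > 0"
        using e'(2)[of "t - (s + c)"] c(2) by (simp add: D_eq)
    qed (use e' in simp)
    ultimately show ?thesis
      using S[of "s + c"] c D_eq[of "s + c"] by (simp add: crossing_time_def sliding_manifold_def)
  qed
  ultimately have "own_piece model i j s (s + b) X"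
    using b cont X c(1) by (auto simp: own_piece_def intro!: bexI[of _ "s + c"])
  moreover have "X s = x0"
    using full_state_eqI[OF ij, of x0] x0 by (simp add: X_def init own_start_def)
  moreover have "X (s + b) \<in> sharing_start j i"
    using fin bounds[of b] b
    by (auto simp: sharing_start_def X_def both_full_full_state[OF ij] full_state_simps[OF ij]
        all_pair[OF ij])
  ultimately show thesis using that by blast
qed

lemma sharing_piece_cong:
  assumes "sharing_piece P i j s t x" and eq: "\<And>r. r \<in> {s..t} \<Longrightarrow> y r = x r"
  shows "sharing_piece P i j s t y"
proof -
  have "continuous_on {s..t} y \<longleftrightarrow> continuous_on {s..t} x" using eq by (rule continuous_on_cong[OF refl])
  moreover have "(y has_vector_derivative v) (at r)"
    if "(x has_vector_derivative v) (at r)" "r \<in> {s<..<t}" for v r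
    by (rule has_vector_derivative_transform_within_open[OF that(1), of "{s<..<t}"])
      (use that(2) eq in auto)
  ultimately show ?thesis using assms(1) eq by (auto simp: sharing_piece_def)
qed

lemma own_piece_cong:
  assumes "own_piece P i j s t x" and eq: "\<And>r. r \<in> {s..t} \<Longrightarrow> y r = x r"
  shows "own_piece P i j s t y"
proof -
  have crossing: "crossing_time P j i y d" if d: "crossing_time P j i x d" "d \<in> {s<..<t}" for d
  proof -
    have ev: "(\<forall>\<^sub>F r in at_left d. Q (y r)) \<longleftrightarrow> (\<forall>\<^sub>F r in at_left d. Q (x r))"
      "(\<forall>\<^sub>F r in at_right d. Q (y r)) \<longleftrightarrow> (\<forall>\<^sub>F r in at_right d. Q (x r))" for Q
      using d(2) eq
      by (auto intro!: eventually_subst eventually_at_leftI[of s] eventually_at_rightI[of _ t])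
    show ?thesis
      using d eq[of d] ev[of "\<lambda>z. dif P j i z < 0"] ev[of "\<lambda>z. dif P j i z > 0"]
      by (simp add: crossing_time_def)
  qed
  have "continuous_on {s..t} y \<longleftrightarrow> continuous_on {s..t} x" using eq by (rule continuous_on_cong[OF refl])
  moreover have "(y has_vector_derivative v) (at r)"
    if "(x has_vector_derivative v) (at r)" "r \<in> {s<..<t}" for v r
    by (rule has_vector_derivative_transform_within_open[OF that(1), of "{s<..<t}"])
      (use that(2) eq in auto)
  moreover obtain d where "d \<in> {s<..<t}" "crossing_time P j i x d"
    using assms(1) by (auto simp: own_piece_def)
  then have "\<exists>d\<in>{s<..<t}. crossing_time P j i y d" using crossing by blast
  ultimately show ?thesis using assms(1) eq by (auto simp: own_piece_def)
qed

section \<open>An oscillating solution\<close>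

text \<open>
  The gluing function uses the first piece whose interval has not ended before \<open>t\<close>; at a
  common end point that is the earlier piece, where both have the same value.
\<close>

lemma glue_pieces:
  fixes T :: "nat \<Rightarrow> real" and X :: "nat \<Rightarrow> real \<Rightarrow> 'a"
  assumes less: "\<And>n. T n < T (Suc n)"
    and match: "\<And>n. X n (T (Suc n)) = X (Suc n) (T (Suc n))"
  obtains x where "\<And>n t. t \<in> {T n..T (Suc n)} \<Longrightarrow> x t = X n t"
proof
  fix n t assume t: "t \<in> {T n..T (Suc n)}"
  have mono: "T m \<le> T n" if "m \<le> n" for m n
    using that by (rule lift_Suc_mono_le[of T, OF less_imp_le[OF less]])
  define m where "m = (LEAST n. t \<le> T (Suc n))"
  have m: "t \<le> T (Suc m)" "m \<le> n"
    unfolding m_def using t by (auto intro: LeastI Least_le)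
  show "X (LEAST n. t \<le> T (Suc n)) t = X n t"
  proof (cases "m = n")
    case False
    then obtain k where k: "n = Suc k" "m \<le> k"
      using m(2) by (cases n) auto
    then have "t = T n" using t m(1) mono[of "Suc m" n] by simp
    then have "t \<le> T (Suc k)" "T k < t" using k less by auto
    then have "\<not> Suc m \<le> k" using m(1) mono[of "Suc m" k] by auto
    then have "m = k" using k(2) by simp
    then show ?thesis using match[of k] \<open>t = T n\<close> k(1) m_def by simp
  qed (simp add: m_def)
qed

text \<open>
  Pieces with and without sharing alternate, and the classes are exchanged after every pair of
  pieces, so the pattern has period four. Class 2 is helped first.
\<close>

definition helped :: "nat \<Rightarrow> 2" where
  "helped n = (if even (n div 2) then 2 else 1)"

definition helper :: "nat \<Rightarrow> 2" where
  "helper n = (if even (n div 2) then 1 else 2)"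

lemma helped_neq_helper: "helped n \<noteq> helper n"
  by (simp add: helped_def helper_def)

lemma helped_Suc:
  "even n \<Longrightarrow> helped (Suc n) = helped n" "even n \<Longrightarrow> helper (Suc n) = helper n"
  "odd n \<Longrightarrow> helped (Suc n) = helper n" "odd n \<Longrightarrow> helper (Suc n) = helped n"
  by (auto simp: helped_def helper_def elim!: oddE evenE)

definition piece :: "nat \<Rightarrow> real \<Rightarrow> real \<Rightarrow> (real \<Rightarrow> state) \<Rightarrow> bool" where
  "piece n = (if even n then sharing_piece else own_piece) model (helped n) (helper n)"

definition piece_start :: "nat \<Rightarrow> state set" where
  "piece_start n = (if even n then sharing_start else own_start) (helped n) (helper n)"

lemma piece_exists:
  assumes "z \<in> piece_start n"
  shows "\<exists>t x. piece n s t x \<and> x s = z \<and> x t \<in> piece_start (Suc n)"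
proof (cases "even n")
  case True
  then show ?thesis
    using sharing_piece_exists[OF helped_neq_helper, of z n s] assms
    by (simp add: piece_def piece_start_def helped_Suc) metis
next
  case False
  then show ?thesis
    using own_piece_exists[OF helped_neq_helper, of z n s] assms
    by (simp add: piece_def piece_start_def helped_Suc) metis
qed

lemma piece_cong:
  assumes "piece n s t x" "\<And>r. r \<in> {s..t} \<Longrightarrow> y r = x r"
  shows "piece n s t y"
  using assms sharing_piece_cong own_piece_cong unfolding piece_def by presburger

lemma piece_sequence_exists:
  assumes x0: "x0 \<in> piece_start 0"
  obtains T x where "T 0 = 0" "x 0 = x0" "\<And>n. piece n (T n) (T (Suc n)) x"
proof -
  let ?P = "\<lambda>(n::nat) (t::real, z). z \<in> piece_start n \<and> (n = 0 \<longrightarrow> t = 0 \<and> z = x0)"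
  let ?Q = "\<lambda>n (s, z) (t, z'). \<exists>x. piece n s t x \<and> x s = z \<and> x t = z'"
  have "\<exists>f. \<forall>n. ?P n (f n) \<and> ?Q n (f n) (f (Suc n))"
  proof (rule dependent_nat_choice)
    show "\<exists>c. ?P 0 c" using x0 by (intro exI[of _ "(0, x0)"]) simp
  next
    fix c n assume c: "?P n c"
    obtain s z where sz: "c = (s, z)" by (rule prod.exhaust)
    then obtain t x where "piece n s t x" "x s = z" "x t \<in> piece_start (Suc n)"
      using piece_exists[of z n s] c by auto
    then show "\<exists>c'. ?P (Suc n) c' \<and> ?Q n c c'"
      unfolding sz by (intro exI[of _ "(t, x t)"]) auto
  qed
  then obtain f where f: "\<And>n. ?P n (f n) \<and> ?Q n (f n) (f (Suc n))" by blast
  define T where "T n = fst (f n)" for n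
  have "\<exists>x. piece n (T n) (T (Suc n)) x \<and> x (T n) = snd (f n) \<and> x (T (Suc n)) = snd (f (Suc n))" for n
    using f[of n] by (auto simp: T_def split_beta)
  then obtain X where X: "\<And>n. piece n (T n) (T (Suc n)) (X n)" "\<And>n. X n (T n) = snd (f n)"
    "\<And>n. X n (T (Suc n)) = snd (f (Suc n))" by metis
  have "T n < T (Suc n)" for n
    using X(1)[of n] by (auto simp: piece_def sharing_piece_def own_piece_def split: if_splits)
  then obtain x where x: "\<And>n t. t \<in> {T n..T (Suc n)} \<Longrightarrow> x t = X n t"
    using glue_pieces[of T X] X(2,3) by metis
  show thesis
  proof (rule that)
    show "T 0 = 0" using f[of 0] by (auto simp: T_def)
    then show "x 0 = x0"
      using x[of 0 0] X(2)[of 0] f[of 0] \<open>T 0 < T (Suc 0)\<close> by (auto simp: split_beta)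
    show "piece n (T n) (T (Suc n)) x" for n
      using piece_cong[OF X(1)[of n]] x by blast
  qed
qed

locale piecewise_trajectory =
  fixes T :: "nat \<Rightarrow> real" and x :: "real \<Rightarrow> state"
  assumes T_0: "T 0 = 0" and pieces: "\<And>n. piece n (T n) (T (Suc n)) x"
begin

lemma T_step: "T n + 1 \<le> T (Suc n)"
  using pieces[of n] by (auto simp: piece_def sharing_piece_def own_piece_def split: if_splits)

lemma T_ge: "real n \<le> T n"
proof (induction n)
  case (Suc n)
  then show ?case using T_step[of n] by simp
qed (simp add: T_0)

lemma T_bracket:
  assumes "0 \<le> t"
  obtains n where "T n \<le> t" "t < T (Suc n)"
proof -
  obtain m where "t < real m" using reals_Archimedean2 by blast
  then have ex: "t < T (Suc m)" using T_ge[of "Suc m"] by simp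
  define n where "n = (LEAST n. t < T (Suc n))"
  have n: "t < T (Suc n)" unfolding n_def by (rule LeastI[of _ m]) (rule ex)
  have "T n \<le> t"
  proof (cases n)
    case (Suc k)
    then have "\<not> t < T (Suc k)" using not_less_Least[of k "\<lambda>n. t < T (Suc n)"] n_def by simp
    then show ?thesis using Suc by simp
  qed (use assms T_0 in simp)
  then show thesis using that n by blast
qed

lemma continuous_upto: "continuous_on {0..T n} x"
proof (induction n)
  case (Suc n)
  have "continuous_on {T n..T (Suc n)} x"
    using pieces[of n] by (auto simp: piece_def sharing_piece_def own_piece_def split: if_splits)
  then have "continuous_on ({0..T n} \<union> {T n..T (Suc n)}) x"
    using Suc by (intro continuous_on_closed_Un) auto
  moreover have "{0..T n} \<union> {T n..T (Suc n)} = {0..T (Suc n)}"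
    using T_ge[of n] T_step[of n] by auto
  ultimately show ?case by simp
qed (simp add: T_0)

lemma continuous: "continuous_on {0..} x"
  unfolding continuous_on_eq_continuous_within
proof
  fix t :: real assume t: "t \<in> {0..}"
  then obtain n where n: "t < T n" using T_bracket[of t] by auto
  have "continuous (at t within {0..T n}) x"
    using continuous_upto[of n] t n by (simp add: continuous_on_eq_continuous_within)
  moreover have "at t within {0..T n} = at t within {0..}"
    by (rule at_within_nhd[of t "{..<T n}"]) (use n in auto)
  ultimately show "continuous (at t within {0..}) x" by simp
qed

text \<open>
  A piece without sharing says nothing about its left end, which is the right end of the
  sharing piece before it.
\<close>

lemma piece_cases:
  assumes "T n \<le> t" "t < T (Suc n)"
  shows "x t \<in> sharing_states model (helped n) (helper n)
      \<or> odd n \<and> t = T n \<and> x t \<in> exit_states model (helped n) (helper n)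
      \<or> x t \<in> own_states model (helped n) (helper n)"
proof (cases "even n")
  case True
  then show ?thesis using pieces[of n] assms by (auto simp: piece_def sharing_piece_def)
next
  case False
  show ?thesis
  proof (cases "t = T n")
    case True
    obtain m where m: "n = Suc m" "even m" using False by (cases n) auto
    then show ?thesis
      using pieces[of m] True False by (auto simp: piece_def sharing_piece_def helped_Suc)
  next
    case False
    then show ?thesis
      using \<open>odd n\<close> pieces[of n] assms by (auto simp: piece_def own_piece_def)
  qed
qed

lemma regular:
  assumes "0 \<le> t"
  shows "x t \<in> regular_states model"
proof -
  obtain n where "T n \<le> t" "t < T (Suc n)" using T_bracket[OF assms] by blast
  from piece_cases[OF this] show ?thesis
    using helped_neq_helper[of n] unfolding regular_states_def by blast
qed

lemma velocity_off_switches: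
  assumes t: "0 < t" "t \<notin> range T"
  shows "\<exists>u. admissible model (x t) u \<and> (x has_vector_derivative velocity model (x t) u) (at t)"
proof -
  obtain n where n: "T n \<le> t" "t < T (Suc n)" using T_bracket[of t] t(1) by auto
  with t(2) have n': "t \<in> {T n<..<T (Suc n)}" by (metis greaterThanLessThan_iff order_le_less rangeI)
  show ?thesis
  proof (cases "even n")
    case True
    then have "x t \<in> active_sharing model (helped n) (helper n)"
      "(x has_vector_derivative sharing_field model (helped n) (x t)) (at t)"
      using pieces[of n] n' by (auto simp: piece_def sharing_piece_def sharing_states_def)
    then show ?thesis
      using admissible_sharing_iff[OF model_standing helped_neq_helper] by (auto simp: sharing_field_def)
  next
    case False
    then have "x t \<in> own_states model (helped n) (helper n)"
      "(x has_vector_derivative own_field model (x t)) (at t)"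
      using pieces[of n] n' by (auto simp: piece_def own_piece_def)
    then show ?thesis
      using admissible_own_states_iff[OF model_standing helped_neq_helper] by (auto simp: own_field_def)
  qed
qed

lemma fluid_solution: "fluid_solution model x"
proof -
  define v where "v t = vector_derivative x (at t)" for t
  have v: "(x has_vector_derivative v t) (at t) \<and> (\<exists>u. admissible model (x t) u \<and> v t = velocity model (x t) u)"
    if "0 < t" "t \<notin> range T" for t
    using velocity_off_switches[OF that] by (auto simp: v_def vector_derivative_at)
  have int: "(v has_integral (x t - x 0)) {0..t}" if t: "0 \<le> t" for t
  proof -
    obtain m where m: "t < real m" using reals_Archimedean2 by blast
    show ?thesis
    proof (rule fundamental_theorem_of_calculus_interior_strong)
      show "finite (T ` {..m})" by simp
      fix r assume r: "r \<in> {0<..<t} - T ` {..m}"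
      have "r \<noteq> T n" for n
        using r T_ge[of n] m by (cases "n \<le> m") auto
      then show "(x has_vector_derivative v r) (at r)" using v[of r] r by auto
    next
      show "continuous_on {0..t} x" by (rule continuous_on_subset[OF continuous]) auto
    qed (rule t)
  qed
  have "negligible (\<Union>((\<lambda>n. {T n}) ` UNIV))" by (rule negligible_countable_Union) auto
  then have "negligible (range T)" by (simp add: UNION_singleton_eq_range)
  moreover have "x t \<in> state_space model \<and> non_idling model (x t)" if "0 \<le> t" for t
    using regular[OF that]
    by (auto simp: regular_states_def sharing_states_def active_sharing_def exit_states_def
        sliding_manifold_def own_states_def both_full_def non_idling_def)
  ultimately show ?thesis
    unfolding fluid_solution_def using continuous int v by blast
qed

lemma switches_at_even_piece_end:
  assumes n: "even n"
  shows "switch_time model x (T (Suc n))"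
    and "crossing_time model (helped n) (helper n) x (T (Suc n))"
    and "\<exists>d>T (Suc n). crossing_time model (helper n) (helped n) x d"
proof -
  let ?i = "helped n" and ?j = "helper n" and ?t = "T (Suc n)"
  have sh: "\<And>r. r \<in> {T n..<?t} \<Longrightarrow> x r \<in> sharing_states model ?i ?j"
    and ex: "x ?t \<in> exit_states model ?i ?j"
    using pieces[of n] n by (auto simp: piece_def sharing_piece_def)
  have ow: "\<And>r. r \<in> {?t<..<T (Suc (Suc n))} \<Longrightarrow> x r \<in> own_states model ?i ?j"
    and cr: "\<exists>d\<in>{?t<..<T (Suc (Suc n))}. crossing_time model ?j ?i x d"
    using pieces[of "Suc n"] n by (auto simp: piece_def own_piece_def helped_Suc)
  have left: "\<forall>\<^sub>F r in at_left ?t. x r \<in> sharing_states model ?i ?j"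
    by (rule eventually_at_leftI[of "T n"]) (use sh T_step[of n] in auto)
  have right: "\<forall>\<^sub>F r in at_right ?t. x r \<in> own_states model ?i ?j"
    by (rule eventually_at_rightI[of _ "T (Suc (Suc n))"]) (use ow T_step[of "Suc n"] in auto)
  have own_none: "z \<in> no_active_sharing model" if "z \<in> own_states model ?i ?j" for z
    using that unfolding no_active_sharing_def own_states_def all_pair[OF helped_neq_helper[of n]]
    by auto
  have "active_sharing model ?i ?j \<noteq> no_active_sharing model"
  proof -
    have "x (T n) \<in> sharing_states model ?i ?j" using sh[of "T n"] T_step[of n] by simp
    then have act: "x (T n) \<in> active_sharing model ?i ?j" by (simp add: sharing_states_def)
    then have "\<not> (dif model ?i ?j (x (T n)) < 0 \<or> serv (x (T n)) ?j ?i > tau model)"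
      by (auto simp: active_sharing_def)
    then have "x (T n) \<notin> no_active_sharing model"
      using helped_neq_helper[of n] unfolding no_active_sharing_def by blast
    with act show ?thesis by blast
  qed
  moreover have "active_sharing model ?i ?j \<in> regimes model"
    by (auto simp: helped_def helper_def regimes_def)
  moreover have "no_active_sharing model \<in> regimes model" by (simp add: regimes_def)
  moreover have "\<forall>\<^sub>F r in at_left ?t. x r \<in> active_sharing model ?i ?j"
    using left by eventually_elim (simp add: sharing_states_def)
  moreover have "\<forall>\<^sub>F r in at_right ?t. x r \<in> no_active_sharing model"
    using right by eventually_elim (rule own_none)
  ultimately show "switch_time model x ?t" unfolding switch_time_def by blast
  have "\<forall>\<^sub>F r in at_left ?t. dif model ?i ?j (x r) > 0"
    using left by eventually_elim (simp add: sharing_states_def active_sharing_def)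
  moreover have "\<forall>\<^sub>F r in at_right ?t. dif model ?i ?j (x r) < 0"
    using right by eventually_elim (simp add: own_states_def)
  ultimately show "crossing_time model ?i ?j x ?t"
    using ex by (simp add: crossing_time_def exit_states_def)
  show "\<exists>d>?t. crossing_time model ?j ?i x d" using cr by auto
qed

lemma oscillates: "oscillates_indefinitely model x"
proof -
  have late: "\<exists>n. even n \<and> t < T (Suc n)" for t
  proof -
    obtain m where "t < real m" using reals_Archimedean2 by blast
    then have "t < T (Suc (2 * m))" using T_ge[of "Suc (2 * m)"] by simp
    then show ?thesis by (intro exI[of _ "2 * m"]) simp
  qed
  have cross: "\<exists>s>t. crossing_time model i j x s" if ij: "i \<noteq> j" for t i j
  proof -
    obtain n where n: "even n" "t < T (Suc n)" using late by blast
    have "i = helped n \<and> j = helper n \<or> i = helper n \<and> j = helped n"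
      using ij by (elim pair_cases) (auto simp: helped_def helper_def)
    then show ?thesis
    proof
      assume "i = helped n \<and> j = helper n"
      then show ?thesis using switches_at_even_piece_end(2)[OF n(1)] n(2) by auto
    next
      assume *: "i = helper n \<and> j = helped n"
      obtain d where "T (Suc n) < d" "crossing_time model (helper n) (helped n) x d"
        using switches_at_even_piece_end(3)[OF n(1)] by blast
      then show ?thesis using * n(2) by (intro exI[of _ d]) auto
    qed
  qed
  have switch: "\<exists>s>t. switch_time model x s" for t
    using late[of t] switches_at_even_piece_end(1) by blast
  show ?thesis
    unfolding oscillates_indefinitely_def using switch cross by simp
qed

end

theorem theorem5p5:
  shows "\<exists>(P::params) (x0::state).
    standing_assumptions P \<and>
    x0 \<in> state_space P \<and> both_full x0 \<and>
    queue x0 1 > 0 \<and> queue x0 2 > queue x0 1 + kappa P \<and>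
    serv x0 1 2 = tau P \<and> 0 \<le> serv x0 2 1 \<and> serv x0 2 1 < tau P \<and>
    x0 \<in> oscillating_states P"
proof -
  \<comment> \<open>The values lie well inside the box \<open>sharing_start 2 1\<close>.\<close>
  define x0 where "x0 = full_state 2 1 28 20 0 (1/1024)"
  have ij: "(2::2) \<noteq> 1" by simp
  note simps = full_state_simps[OF ij] both_full_full_state[OF ij]
  have start: "x0 \<in> piece_start 0"
    by (simp add: piece_start_def helped_def helper_def sharing_start_def x0_def simps forall_2)
  have space: "x0 \<in> state_space model"
    by (simp add: x0_def full_state_in_state_space[OF ij])
  obtain T x where T: "T 0 = 0" "\<And>n. piece n (T n) (T (Suc n)) x" and x: "x 0 = x0"
    using piece_sequence_exists[OF start] by metis
  interpret piecewise_trajectory T x by unfold_locales (rule T)+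
  have "oscillates_indefinitely model y" if y: "fluid_solution model y" "y 0 = x0" for y
  proof (rule oscillates_transfer[OF _ oscillates])
    show "x t = y t" if "0 \<le> t" for t
      using regular_solution_unique[OF model_standing fluid_solution y(1) _ regular that] x y(2)
      by simp
  qed
  then have "x0 \<in> oscillating_states model"
    using space fluid_solution x by (auto simp: oscillating_states_def)
  then show ?thesis
    using space model_standing by (intro exI[of _ model] exI[of _ x0]) (simp add: x0_def simps)
qed

end
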